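(* Let $u_1,u_2,u_3,u_4\in\mathbb{R}^2$ (points with coordinates $(x,t)$) be, in cyclic order, the vertices of a strictly convex quadrilateral, and let $f_1,f_2,f_3,f_4\in\mathbb{R}$. Let $\mathbb{T}$ and $\mathbb{T}^{\ast}$ be the two triangulations of the quadrilateral, $\mathbb{T}=\{(u_1,u_2,u_4),(u_2,u_3,u_4)\}$ and $\mathbb{T}^{\ast}=\{(u_1,u_2,u_3),(u_1,u_3,u_4)\}$, and let $G$ and $H$ be the continuous functions that are affine on each triangle of $\mathbb{T}$ and of $\mathbb{T}^{\ast}$, respectively, and satisfy $G(u_i)=H(u_i)=f_i$ for $i=1,2,3,4$. If $\mathbb{T}$ is an anisotropic Delaunay triangulation with respect to the metric $M_v$ (see context), then $\mathbb{T}$ yields a roughness no larger than that of the other triangulation $\mathbb{T}^{\ast}$: $$|H|_{\mathbb{T}^{\ast}}^{2}-|G|_{\mathbb{T}}^{2}\ \ge\ 0.$$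
   Context: Let $\mathfrak{c}=\mathfrak{c}(x)$ be a positive smooth scalar function (a characteristic speed). Let $v=(x_v,t_v)$ be the midpoint of the diagonal of the quadrilateral that is being tested for an edge flip, and set $\mathfrak{c}_v=\mathfrak{c}(x_v)>0$, a fixed positive constant. The metric at $v$ is $$M_v=\begin{bmatrix}1&0\\0&\mathfrak{c}_v^{2}\end{bmatrix},$$ and squared distances between points $P_1,P_2\in\mathbb{R}^2$ are measured by $(P_2-P_1)^{T}M_v(P_2-P_1)$. Anisotropic Delaunay criterion: the metric-weighted circumcircle of a triangle is the set of points at metric distance $r_M$ from $o_M$, where $o_M$ is the point equidistant in the $M_v$-metric from the three vertices and $r_M$ is that common distance (equivalently, it is the ordinary circumcircle after applying $(x,t)\mapsto(x,\mathfrak{c}_v t)$). The triangulation $\mathbb{T}$ is anisotropic Delaunay if $u_3$ does not lie strictly inside the metric-weighted circumcircle of the triangle $(u_1,u_2,u_4)$, i.e. $(o_M-u_3)^{T}M_v(o_M-u_3)-r_M^2\ge 0$ for the metric circumcenter $o_M$ and circumradius $r_M$ of $(u_1,u_2,u_4)$. Roughness: for a weakly differentiable function $g(x,t)$ and a triangulation $\mathbb{T}$ consisting of two triangles $T_{1,\mathbb{T}},T_{2,\mathbb{T}}$, $$|g|_{\mathbb{T}}^{2}=\sum_{j=1}^{2}\int_{T_{j,\mathbb{T}}}\left(\mathfrak{c}_v\left(\frac{\partial g}{\partial x}\right)^2+\frac{1}{\mathfrak{c}_v}\left(\frac{\partial g}{\partial t}\right)^2\right)dx\,dt,$$ and likewise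 for $\mathbb{T}^{\ast}$. *)

theory Defs
  imports "HOL-Analysis.Analysis"
begin

text \<open>Points of the plane have type \<^typ>\<open>real^2\<close>; component 1 is \<open>x\<close> and component 2 is \<open>t\<close>.\<close>

definition smooth_real :: "(real \<Rightarrow> real) \<Rightarrow> bool" where
  "smooth_real c \<longleftrightarrow> (\<forall>n x. (deriv ^^ n) c differentiable (at x))"

text \<open>Four distinct vertices of the convex hull, with consecutive ones joined by the sides. No three
  of the points are collinear, since all four are extreme.\<close>

definition strictly_convex_quadrilateral ::
    "real^2 \<Rightarrow> real^2 \<Rightarrow> real^2 \<Rightarrow> real^2 \<Rightarrow> bool" where
  "strictly_convex_quadrilateral u1 u2 u3 u4 \<longleftrightarrow>
     (let Q = convex hull {u1, u2, u3, u4} in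
        distinct [u1, u2, u3, u4] \<and>
        {p. p extreme_point_of Q} = {u1, u2, u3, u4} \<and>
        closed_segment u1 u2 edge_of Q \<and> closed_segment u2 u3 edge_of Q \<and>
        closed_segment u3 u4 edge_of Q \<and> closed_segment u4 u1 edge_of Q)"

type_synonym triangle = "(real^2) \<times> (real^2) \<times> (real^2)"

fun triangle_region :: "triangle \<Rightarrow> (real^2) set" where
  "triangle_region (a, b, c) = convex hull {a, b, c}"

definition triangulated_region :: "triangle set \<Rightarrow> (real^2) set" where
  "triangulated_region T = (\<Union>\<tau>\<in>T. triangle_region \<tau>)"

definition piecewise_affine_on :: "triangle set \<Rightarrow> (real^2 \<Rightarrow> real) \<Rightarrow> bool" where
  "piecewise_affine_on T g \<longleftrightarrow>
     continuous_on (triangulated_region T) g \<and>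
     (\<forall>\<tau>\<in>T. \<exists>a b. \<forall>p\<in>triangle_region \<tau>. g p = a \<bullet> p + b)"

definition metric_matrix :: "real \<Rightarrow> real^2^2" where
  "metric_matrix cv = vector [vector [1, 0], vector [0, cv\<^sup>2]]"

definition metric_sqdist :: "real^2^2 \<Rightarrow> real^2 \<Rightarrow> real^2 \<Rightarrow> real" where
  "metric_sqdist M p q = (q - p) \<bullet> (M *v (q - p))"

text \<open>For a positive definite \<open>M\<close> and a nondegenerate triangle the equidistant point exists and is
  unique.\<close>

definition metric_circumcenter :: "real^2^2 \<Rightarrow> real^2 \<Rightarrow> real^2 \<Rightarrow> real^2 \<Rightarrow> real^2" where
  "metric_circumcenter M a b c =
     (THE z. metric_sqdist M a z = metric_sqdist M b z \<and>
             metric_sqdist M b z = metric_sqdist M c z)"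

definition metric_circumradius :: "real^2^2 \<Rightarrow> real^2 \<Rightarrow> real^2 \<Rightarrow> real^2 \<Rightarrow> real" where
  "metric_circumradius M a b c = sqrt (metric_sqdist M a (metric_circumcenter M a b c))"

text \<open>The criterion for the triangulation with diagonal \<open>u2 u4\<close> of the quadrilateral with vertices
  \<open>u1, u2, u3, u4\<close> in cyclic order.\<close>

definition anisotropic_delaunay ::
    "real^2^2 \<Rightarrow> real^2 \<Rightarrow> real^2 \<Rightarrow> real^2 \<Rightarrow> real^2 \<Rightarrow> bool" where
  "anisotropic_delaunay M u1 u2 u3 u4 \<longleftrightarrow>
     metric_sqdist M u3 (metric_circumcenter M u1 u2 u4)
       - (metric_circumradius M u1 u2 u4)\<^sup>2 \<ge> 0"

definition partial_deriv :: "2 \<Rightarrow> (real^2 \<Rightarrow> real) \<Rightarrow> real^2 \<Rightarrow> real" where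
  "partial_deriv i \<phi> p = frechet_derivative \<phi> (at p) (axis i 1)"

definition test_function :: "(real^2) set \<Rightarrow> (real^2 \<Rightarrow> real) \<Rightarrow> bool" where
  "test_function \<Omega> \<phi> \<longleftrightarrow>
     (\<forall>is p. foldr partial_deriv is \<phi> differentiable (at p)) \<and>
     compact (closure {p. \<phi> p \<noteq> 0}) \<and> closure {p. \<phi> p \<noteq> 0} \<subseteq> \<Omega>"

definition locally_integrable_on :: "(real^2 \<Rightarrow> real) \<Rightarrow> (real^2) set \<Rightarrow> bool" where
  "locally_integrable_on g \<Omega> \<longleftrightarrow> (\<forall>K. compact K \<and> K \<subseteq> \<Omega> \<longrightarrow> g absolutely_integrable_on K)"

definition has_weak_partial ::
    "(real^2) set \<Rightarrow> 2 \<Rightarrow> (real^2 \<Rightarrow> real) \<Rightarrow> (real^2 \<Rightarrow> real) \<Rightarrow> bool" where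
  "has_weak_partial \<Omega> i g h \<longleftrightarrow>
     locally_integrable_on g \<Omega> \<and> locally_integrable_on h \<Omega> \<and>
     (\<forall>\<phi>. test_function \<Omega> \<phi> \<longrightarrow>
        (LINT p:\<Omega>|lebesgue. g p * partial_deriv i \<phi> p) = - (LINT p:\<Omega>|lebesgue. h p * \<phi> p))"

text \<open>For weakly differentiable \<open>g\<close> and open \<open>\<Omega>\<close> this is determined up to a null set of \<open>\<Omega>\<close>.\<close>

definition weak_partial :: "(real^2) set \<Rightarrow> 2 \<Rightarrow> (real^2 \<Rightarrow> real) \<Rightarrow> real^2 \<Rightarrow> real" where
  "weak_partial \<Omega> i g = (SOME h. has_weak_partial \<Omega> i g h)"

text \<open>The squared seminorm \<open>|g|\<^sup>2\<close> of a function \<open>g\<close> that is weakly differentiable in the interior of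
  the triangulated region. The choice of representatives of the weak derivatives does not matter,
  the boundary of the region being a null set.\<close>

definition roughness_sq :: "real \<Rightarrow> triangle set \<Rightarrow> (real^2 \<Rightarrow> real) \<Rightarrow> real" where
  "roughness_sq cv T g =
     (let \<Omega> = interior (triangulated_region T) in
        \<Sum>\<tau>\<in>T. LINT p:triangle_region \<tau>|lebesgue.
          cv * (weak_partial \<Omega> 1 g p)\<^sup>2 + (1 / cv) * (weak_partial \<Omega> 2 g p)\<^sup>2)"

end

theory Submission
  imports Defs "HOL-Computational_Algebra.Polynomial"
begin

text \<open>
  Flipping the diagonal changes the roughness by a square times the power of a point with respect
  to a circle, and the Delaunay criterion fixes the sign of that power.

  On a triangle the gradient of an interpolant is constant, so the roughness of a triangulation is a
  sum of areas times energies \<open>cv a\<^sub>1\<^sup>2 + a\<^sub>2\<^sup>2 / cv\<close> of gradients \<open>a\<close>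
  (\<open>roughness_sq_piecewise_affine\<close>). Let \<open>\<delta>\<close> be the defect of the data at \<open>u3\<close> from the affine function
  through the data at \<open>u1\<close>, \<open>u2\<close>, \<open>u4\<close>. All four gradients are then equal up to \<open>\<delta>\<close> times a
  side vector turned by a right angle and divided by twice the triangle area. In the
  difference of the roughnesses everything of order zero and one in \<open>\<delta>\<close> cancels, and the
  coefficient of \<open>\<delta>\<^sup>2\<close> is \<open>\<bar>u2 - u1\<bar>\<^sup>2 / A + \<bar>u4 - u1\<bar>\<^sup>2 / E - \<bar>u4 - u2\<bar>\<^sup>2 / C\<close> up to the
  positive factor \<open>1 / (2 cv)\<close>. Here the lengths are taken in the metric and \<open>A\<close>, \<open>E\<close>, \<open>C\<close> are twice
  the areas of \<open>u1 u2 u3\<close>, \<open>u1 u3 u4\<close> and \<open>u2 u3 u4\<close> (\<open>edge_flip_energy\<close>). Turning a vector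
  by a right angle exchanges the weights \<open>cv\<close> and \<open>1 / cv\<close> of the energy, which is why exactly
  this metric occurs. Multiplied by \<open>A E C\<close>, the coefficient is a square times the power of \<open>u3\<close>
  with respect to the metric circumcircle of \<open>u1 u2 u4\<close>, which is nonnegative by the Delaunay
  criterion (\<open>delaunay_weighted_sum_nonneg\<close>). The areas have a common sign because all sides of the
  quadrilateral are edges of its convex hull (\<open>strictly_convex_quadrilateral_orient\<close>).

  The roughness refers to arbitrarily chosen weak derivatives, so the constant gradients have to be
  recovered from them. They are weak derivatives: for Lipschitz functions, almost everywhere classical
  derivatives are weak ones (\<open>Lipschitz_has_weak_partial\<close>), by translation invariance of the integral.
  Weak derivatives are unique almost everywhere (\<open>has_weak_partial_AE_unique\<close>), because
  test functions approximate the indicators of rectangles boundedly and pointwise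
  (\<open>box_bump_tendsto_indicator\<close>).\<close>

section \<open>Smooth bump functions on rectangles\<close>

definition interval_poly :: "real \<Rightarrow> real \<Rightarrow> real poly" where
  "interval_poly a b = [:-a, 1:] * [:b, -1:]"

text \<open>The polynomial \<open>P\<close> and the exponent \<open>k\<close> are parameters because the family with fixed \<open>a, b, \<epsilon>\<close>
  is then closed under differentiation, with one member as the derivative of another; smoothness of
  every member follows by iterating that one fact.\<close>

definition interval_bump :: "real \<Rightarrow> real \<Rightarrow> real \<Rightarrow> real poly \<Rightarrow> nat \<Rightarrow> real \<Rightarrow> real" where
  "interval_bump a b \<epsilon> P k x =
     (if a < x \<and> x < b
      then poly P x * exp (- \<epsilon> / poly (interval_poly a b) x) / poly (interval_poly a b) x ^ k
      else 0)"

lemma poly_interval_poly: "poly (interval_poly a b) x = (x - a) * (b - x)"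
  by (simp add: interval_poly_def algebra_simps)

text \<open>The factor \<open>exp (-\<epsilon>/q)\<close> beats every negative power of \<open>q\<close>, by a single term of the exponential
  series. Vanishing to second order in \<open>q\<close> is what makes the extension by zero differentiable at
  the end points.\<close>

lemma interval_bump_flat:
  assumes "\<epsilon> > 0"
  shows "\<exists>C. \<forall>x. \<bar>interval_bump a b \<epsilon> P k x\<bar> \<le> C * (poly (interval_poly a b) x)\<^sup>2"
proof -
  have "compact (poly P ` {a..b})"
    by (intro compact_continuous_image continuous_intros) auto
  then have "bounded (poly P ` {a..b})" by (rule compact_imp_bounded)
  then obtain M where M: "M > 0" "\<And>x. x \<in> {a..b} \<Longrightarrow> \<bar>poly P x\<bar> \<le> M"
    unfolding bounded_pos by auto
  \<comment> \<open>\<open>y ^ (k + 2) / fact (k + 2) \<le> exp y\<close> at \<open>y = \<epsilon> / q\<close> turns into \<open>exp (-\<epsilon>/q) \<le> N * q ^ (k + 2)\<close>.\<close>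
  define N where "N = fact (k + 2) / \<epsilon> ^ (k + 2)"
  have "\<bar>interval_bump a b \<epsilon> P k x\<bar> \<le> (M * N) * (poly (interval_poly a b) x)\<^sup>2" for x
  proof (cases "a < x \<and> x < b")
    case True
    define q where "q = poly (interval_poly a b) x"
    have q: "q > 0" using True by (simp add: q_def poly_interval_poly)
    have "(\<epsilon> / q) ^ (k + 2) / fact (k + 2) \<le> exp (\<epsilon> / q)"
    proof -
      have "(\<Sum>n\<in>{k+2}. inverse (fact n) *\<^sub>R (\<epsilon> / q) ^ n) \<le> exp (\<epsilon> / q)"
        unfolding exp_def using q assms
        by (intro sum_le_suminf summable_exp_generic) (auto simp del: power_Suc)
      then show ?thesis by (simp add: divide_inverse mult.commute del: fact_Suc power_Suc add_2_eq_Suc')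
    qed
    then have "inverse (exp (\<epsilon> / q)) \<le> inverse ((\<epsilon> / q) ^ (k + 2) / fact (k + 2))"
      using q assms by (intro le_imp_inverse_le) (auto simp del: power_Suc add_2_eq_Suc' fact_Suc)
    also have "inverse ((\<epsilon> / q) ^ (k + 2) / fact (k + 2)) = N * q\<^sup>2 * q ^ k"
      unfolding N_def power_divide by (simp add: power_add power2_eq_square)
    finally have "exp (- \<epsilon> / q) / q ^ k \<le> N * q\<^sup>2"
      using q by (simp add: exp_minus pos_divide_le_eq)
    moreover have "\<bar>poly P x\<bar> \<le> M" using M True by auto
    ultimately have "\<bar>poly P x\<bar> * (exp (- \<epsilon> / q) / q ^ k) \<le> M * (N * q\<^sup>2)"
      using q M by (intro mult_mono) auto
    then show ?thesis using True q by (simp add: interval_bump_def q_def[symmetric] abs_mult)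
  next
    case False
    have "N \<ge> 0" using assms by (simp add: N_def)
    then show ?thesis using False M by (auto simp add: interval_bump_def)
  qed
  then show ?thesis by blast
qed

lemma has_derivative_zero_quadratic:
  fixes f :: "real \<Rightarrow> real"
  assumes "\<And>y. \<bar>f y\<bar> \<le> C * (y - x)\<^sup>2"
  shows "(f has_real_derivative 0) (at x)"
proof -
  have fx: "f x = 0" using assms[of x] by simp
  have "((\<lambda>h. C * \<bar>h\<bar>) \<longlongrightarrow> C * \<bar>0\<bar>) (at 0)" by (intro tendsto_intros)
  then have C0: "((\<lambda>h. C * \<bar>h\<bar>) \<longlongrightarrow> 0) (at 0)" by simp
  have "\<forall>\<^sub>F h in at 0. norm ((f (x + h) - f x) / h) \<le> C * \<bar>h\<bar>"
  proof (rule eventually_at_filter[THEN iffD2], rule always_eventually, safe)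
    fix h :: real assume "h \<noteq> 0"
    then show "norm ((f (x + h) - f x) / h) \<le> C * \<bar>h\<bar>"
      using assms[of "x + h"] fx power2_abs[of h]
      by (simp add: pos_divide_le_eq power2_eq_square mult.assoc)
  qed
  then have "((\<lambda>h. (f (x + h) - f x) / h) \<longlongrightarrow> 0) (at 0)"
    using C0 by (rule Lim_null_comparison)
  then show ?thesis by (simp add: DERIV_def)
qed

text \<open>Inside the interval, \<open>(exp (-\<epsilon>/q) / q ^ k)'\<close> equals \<open>exp (-\<epsilon>/q) / q ^ (k + 2)\<close> times a polynomial,
  so the derivative stays in the family with \<open>k\<close> raised by two. Outside, and in particular at the
  end points, quadratic flatness gives derivative zero.\<close>

lemma interval_bump_deriv:
  assumes "\<epsilon> > 0"
  shows "\<exists>P'. \<forall>x. (interval_bump a b \<epsilon> P k has_real_derivative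
                    interval_bump a b \<epsilon> P' (k + 2) x) (at x)"
proof -
  define Q where "Q = interval_poly a b"
  define P' where "P' = pderiv P * Q\<^sup>2 - of_nat k * P * pderiv Q * Q + [:\<epsilon>:] * P * pderiv Q"
  have "(interval_bump a b \<epsilon> P k has_real_derivative interval_bump a b \<epsilon> P' (k + 2) x) (at x)" for x
  proof (cases "a < x \<and> x < b")
    case True
    have q: "poly Q x > 0" using True by (simp add: Q_def poly_interval_poly)
    define s where "s = inverse (poly Q x)"
    define d where "d = poly (pderiv Q) x"
    have qs: "poly Q x * s = 1" using q by (simp add: s_def)
    have ds: "((\<lambda>x. inverse (poly Q x)) has_real_derivative - (d * s\<^sup>2)) (at x)"
      using DERIV_inverse_fun[OF poly_DERIV, of Q x] q
      by (simp add: s_def d_def power2_eq_square mult_ac)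
    have "((\<lambda>x. poly P x * (exp (- (\<epsilon> * inverse (poly Q x))) * inverse (poly Q x) ^ k)) has_real_derivative
            poly P x * (exp (- (\<epsilon> * s)) * (real k * (- (d * s\<^sup>2) * s ^ (k - 1)))
              + (exp (- (\<epsilon> * s)) * - (\<epsilon> * - (d * s\<^sup>2))) * s ^ k)
            + poly (pderiv P) x * (exp (- (\<epsilon> * s)) * s ^ k)) (at x)"
      using DERIV_mult'[OF poly_DERIV[of P x]
          DERIV_mult'[OF DERIV_fun_exp[OF DERIV_minus[OF DERIV_cmult[OF ds, of \<epsilon>]]] DERIV_power[OF ds, of k]]]
      by (simp only: s_def[symmetric] of_nat_id One_nat_def)
    moreover have "poly P x * (exp (- (\<epsilon> * s)) * (real k * (- (d * s\<^sup>2) * s ^ (k - 1)))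
              + (exp (- (\<epsilon> * s)) * - (\<epsilon> * - (d * s\<^sup>2))) * s ^ k)
            + poly (pderiv P) x * (exp (- (\<epsilon> * s)) * s ^ k)
          = interval_bump a b \<epsilon> P' (k + 2) x"
    proof -
      \<comment> \<open>The remaining identity, with the powers of \<open>s = 1/q\<close> abstracted to atoms that are related only
        by \<open>q s = 1\<close>.\<close>
      have aux: "v = p * (e * (n * (- (d * s2) * z)) + (e * - (\<epsilon> * - (d * s2))) * y) + p' * (e * y)"
        if "v = r * e * w" "r = p' * q2 - n * p * d * q + \<epsilon> * p * d" "q2 * w = y"
          "n * (q * w) = n * (s2 * z)" "w = s2 * y" for v p e n s2 z y p' r w q2 q :: real
      proof -
        have "v = p' * e * (q2 * w) - p * d * e * (n * (q * w)) + \<epsilon> * p * d * e * w"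
          unfolding that(1,2) by (simp add: algebra_simps)
        then show ?thesis unfolding that(3,4) unfolding that(5) by (simp add: algebra_simps)
      qed
      have "interval_bump a b \<epsilon> P' (k + 2) x = poly P' x * exp (- (\<epsilon> * s)) * s ^ (k + 2)"
        using True
        by (simp add: interval_bump_def Q_def[symmetric] s_def divide_inverse power_inverse del: power_Suc add_2_eq_Suc')
      moreover have "poly P' x = poly (pderiv P) x * (poly Q x)\<^sup>2 - real k * poly P x * d * poly Q x
          + \<epsilon> * poly P x * d"
        by (simp add: P'_def d_def)
      moreover have "(poly Q x)\<^sup>2 * s ^ (k + 2) = s ^ k"
      proof -
        have "(poly Q x)\<^sup>2 * s ^ (k + 2) = (poly Q x * s)\<^sup>2 * s ^ k"
          unfolding power_add power_mult_distrib by (simp only: mult_ac)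
        then show ?thesis using qs by simp
      qed
      moreover have "real k * (poly Q x * s ^ (k + 2)) = real k * (s\<^sup>2 * s ^ (k - 1))"
      proof (cases k)
        case (Suc m)
        have "poly Q x * s ^ (Suc m + 2) = (poly Q x * s) * (s\<^sup>2 * s ^ m)"
          by (simp add: power2_eq_square mult_ac)
        then show ?thesis using qs Suc by simp
      qed auto
      moreover have "s ^ (k + 2) = s\<^sup>2 * s ^ k" by (simp add: power2_eq_square)
      ultimately show ?thesis
        by (rule aux[symmetric])
    qed
    ultimately have "((\<lambda>x. poly P x * exp (- \<epsilon> / poly Q x) / poly Q x ^ k) has_real_derivative
            interval_bump a b \<epsilon> P' (k + 2) x) (at x)"
      by (simp add: divide_inverse power_inverse mult.assoc)
    then show ?thesis
    proof (rule DERIV_cong_ev[OF refl _ refl, THEN iffD1, rotated])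
      have "\<forall>\<^sub>F y in nhds x. y \<in> {a<..<b}" using True by (intro eventually_nhds_in_open) auto
      then show "\<forall>\<^sub>F y in nhds x. poly P y * exp (- \<epsilon> / poly Q y) / poly Q y ^ k
                   = interval_bump a b \<epsilon> P k y"
        by eventually_elim (simp add: interval_bump_def Q_def)
    qed
  next
    case False
    obtain C where C: "\<And>x. \<bar>interval_bump a b \<epsilon> P k x\<bar> \<le> C * (poly (interval_poly a b) x)\<^sup>2"
      using interval_bump_flat[OF assms] by blast
    have "\<bar>interval_bump a b \<epsilon> P k y\<bar> \<le> (\<bar>C\<bar> * (b - a)\<^sup>2) * (y - x)\<^sup>2" for y
    proof (cases "a < y \<and> y < b")
      case True
      have "0 \<le> (y - a) * (b - y)" using True by simp
      \<comment> \<open>A point \<open>y\<close> of the interval is at least as far from \<open>x\<close> as from the end point on the side of \<open>x\<close>;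
        the other factor of \<open>q\<close> is bounded by the length of the interval.\<close>
      moreover have "(y - a) * (b - y) \<le> (b - a) * \<bar>y - x\<bar>"
      proof (cases "x \<le> a")
        case True
        then show ?thesis using \<open>a < y \<and> y < b\<close>
          by (subst mult.commute) (intro mult_mono, auto)
      next
        case x: False
        then show ?thesis using \<open>\<not> (a < x \<and> x < b)\<close> \<open>a < y \<and> y < b\<close>
          by (intro mult_mono) auto
      qed
      ultimately have "((y - a) * (b - y))\<^sup>2 \<le> ((b - a) * \<bar>y - x\<bar>)\<^sup>2"
        by (rule power_mono[rotated])
      then have "\<bar>C\<bar> * ((y - a) * (b - y))\<^sup>2 \<le> \<bar>C\<bar> * ((b - a)\<^sup>2 * (y - x)\<^sup>2)"
        by (intro mult_left_mono) (auto simp: power_mult_distrib)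
      moreover have "C * ((y - a) * (b - y))\<^sup>2 \<le> \<bar>C\<bar> * ((y - a) * (b - y))\<^sup>2"
        by (intro mult_right_mono) auto
      ultimately show ?thesis using C[of y] by (simp add: poly_interval_poly mult.assoc)
    qed (auto simp: interval_bump_def)
    then have "(interval_bump a b \<epsilon> P k has_real_derivative 0) (at x)"
      by (rule has_derivative_zero_quadratic)
    moreover have "interval_bump a b \<epsilon> P' (k + 2) x = 0"
      using False by (auto simp: interval_bump_def)
    ultimately show ?thesis by simp
  qed
  then show ?thesis by blast
qed

definition box_bump :: "real^2 \<Rightarrow> real^2 \<Rightarrow> real \<Rightarrow> real poly \<Rightarrow> nat \<Rightarrow> real poly \<Rightarrow> nat \<Rightarrow> real^2 \<Rightarrow> real"
  where "box_bump a b \<epsilon> P k Q l p =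
    interval_bump (a$1) (b$1) \<epsilon> P k (p$1) * interval_bump (a$2) (b$2) \<epsilon> Q l (p$2)"

lemma box_bump_differentiable:
  assumes "\<epsilon> > 0"
  shows "box_bump a b \<epsilon> P k Q l differentiable (at p)"
    and "\<exists>P' k' Q' l'. partial_deriv i (box_bump a b \<epsilon> P k Q l) = box_bump a b \<epsilon> P' k' Q' l'"
proof -
  obtain P' where P': "\<And>x. (interval_bump (a$1) (b$1) \<epsilon> P k has_real_derivative
      interval_bump (a$1) (b$1) \<epsilon> P' (k + 2) x) (at x)"
    using interval_bump_deriv[OF assms] by blast
  obtain Q' where Q': "\<And>x. (interval_bump (a$2) (b$2) \<epsilon> Q l has_real_derivative
      interval_bump (a$2) (b$2) \<epsilon> Q' (l + 2) x) (at x)"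
    using interval_bump_deriv[OF assms] by blast
  have coord: "((\<lambda>p::real^2. p $ j) has_derivative (\<lambda>v. v $ j)) (at p)" for j p
    by (rule bounded_linear_imp_has_derivative) (rule bounded_linear_vec_nth)
  have D: "(box_bump a b \<epsilon> P k Q l has_derivative
      (\<lambda>v. v$1 * box_bump a b \<epsilon> P' (k + 2) Q l p + v$2 * box_bump a b \<epsilon> P k Q' (l + 2) p)) (at p)" for p
  proof -
    have "((\<lambda>p. interval_bump (a$1) (b$1) \<epsilon> P k (p$1) * interval_bump (a$2) (b$2) \<epsilon> Q l (p$2))
      has_derivative
      (\<lambda>v. interval_bump (a$1) (b$1) \<epsilon> P k (p$1) * (interval_bump (a$2) (b$2) \<epsilon> Q' (l + 2) (p$2) * v$2) +
           (interval_bump (a$1) (b$1) \<epsilon> P' (k + 2) (p$1) * v$1) * interval_bump (a$2) (b$2) \<epsilon> Q l (p$2))) (at p)"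
      using has_derivative_compose[OF coord[of 1] P'[unfolded has_field_derivative_def]]
            has_derivative_compose[OF coord[of 2] Q'[unfolded has_field_derivative_def]]
      by (rule has_derivative_mult)
    then show ?thesis unfolding box_bump_def by (simp add: algebra_simps)
  qed
  show "box_bump a b \<epsilon> P k Q l differentiable (at p)"
    using D by (auto simp: differentiable_def)
  have "frechet_derivative (box_bump a b \<epsilon> P k Q l) (at p) =
      (\<lambda>v. v$1 * box_bump a b \<epsilon> P' (k + 2) Q l p + v$2 * box_bump a b \<epsilon> P k Q' (l + 2) p)" for p
    using frechet_derivative_at[OF D] by simp
  then have *: "partial_deriv i (box_bump a b \<epsilon> P k Q l) =
     (\<lambda>p. axis i 1 $ 1 * box_bump a b \<epsilon> P' (k + 2) Q l p + axis i 1 $ 2 * box_bump a b \<epsilon> P k Q' (l + 2) p)"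
    by (simp add: partial_deriv_def fun_eq_iff)
  consider "i = 1" | "i = 2" using exhaust_2 by blast
  then show "\<exists>P' k' Q' l'. partial_deriv i (box_bump a b \<epsilon> P k Q l) = box_bump a b \<epsilon> P' k' Q' l'"
  proof cases
    case 1
    have "partial_deriv i (box_bump a b \<epsilon> P k Q l) = box_bump a b \<epsilon> P' (k + 2) Q l"
      unfolding * by (simp add: 1 axis_def)
    then show ?thesis by blast
  next
    case 2
    have "partial_deriv i (box_bump a b \<epsilon> P k Q l) = box_bump a b \<epsilon> P k Q' (l + 2)"
      unfolding * by (simp add: 2 axis_def)
    then show ?thesis by blast
  qed
qed

text \<open>Partial derivatives of a product of bumps in separate variables are again such products, so all
  iterated partial derivatives exist.\<close>

lemma test_function_box_bump:
  assumes "\<epsilon> > 0" and "cbox a b \<subseteq> \<Omega>"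
  shows "test_function \<Omega> (box_bump a b \<epsilon> P k Q l)"
proof -
  have iterated: "\<exists>P' k' Q' l'. foldr partial_deriv is (box_bump a b \<epsilon> P k Q l) = box_bump a b \<epsilon> P' k' Q' l'" for "is"
  proof (induction "is")
    case (Cons i "is")
    then obtain P' k' Q' l' where
      "foldr partial_deriv is (box_bump a b \<epsilon> P k Q l) = box_bump a b \<epsilon> P' k' Q' l'" by blast
    then show ?case using box_bump_differentiable(2)[OF assms(1), of i a b P' k' Q' l'] by simp
  next
    case Nil
    show ?case unfolding foldr.simps id_apply by blast
  qed
  have smooth: "foldr partial_deriv is (box_bump a b \<epsilon> P k Q l) differentiable (at p)" for "is" p
  proof -
    obtain P' k' Q' l' where
      eq: "foldr partial_deriv is (box_bump a b \<epsilon> P k Q l) = box_bump a b \<epsilon> P' k' Q' l'"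
      using iterated by blast
    show ?thesis unfolding eq by (rule box_bump_differentiable(1)[OF assms(1)])
  qed
  have "{p. box_bump a b \<epsilon> P k Q l p \<noteq> 0} \<subseteq> cbox a b"
    by (auto simp: box_bump_def interval_bump_def mem_box_cart forall_2 split: if_splits)
  then have "closure {p. box_bump a b \<epsilon> P k Q l p \<noteq> 0} \<subseteq> cbox a b"
    by (rule closure_minimal) (rule closed_cbox)
  moreover from this have "compact (closure {p. box_bump a b \<epsilon> P k Q l p \<noteq> 0})"
    using bounded_subset[OF bounded_cbox] by (simp add: compact_eq_bounded_closed)
  ultimately show ?thesis
    using smooth assms(2) by (auto simp: test_function_def)
qed

text \<open>As \<open>\<epsilon>\<close> tends to zero the bumps with \<open>P = 1\<close>, \<open>k = 0\<close> fill up the whole open rectangle while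
  staying below one. This lets test functions replace indicators of rectangles under an integral,
  without any mollification.\<close>

lemma box_bump_tendsto_indicator:
  "(\<lambda>n. box_bump a b (inverse (real (Suc n))) 1 0 1 0 p) \<longlonglongrightarrow> indicator (box a b) p"
proof -
  have "(\<lambda>n. interval_bump c d (inverse (real (Suc n))) 1 0 x) \<longlonglongrightarrow> (if c < x \<and> x < d then 1 else 0)"
    for c d x :: real
  proof (cases "c < x \<and> x < d")
    case True
    have "(\<lambda>n. exp (- inverse (real (Suc n)) / poly (interval_poly c d) x)) \<longlonglongrightarrow>
           exp (- 0 / poly (interval_poly c d) x)"
      using True
      by (intro tendsto_intros LIMSEQ_inverse_real_of_nat) (simp add: poly_interval_poly)
    then show ?thesis using True by (simp add: interval_bump_def del: of_nat_Suc)
  qed (auto simp: interval_bump_def)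
  then have "(\<lambda>n. box_bump a b (inverse (real (Suc n))) 1 0 1 0 p) \<longlonglongrightarrow>
     (if a$1 < p$1 \<and> p$1 < b$1 then 1 else 0) * (if a$2 < p$2 \<and> p$2 < b$2 then 1 else 0)"
    unfolding box_bump_def by (intro tendsto_mult) auto
  then show ?thesis by (auto simp: indicator_def mem_box_cart forall_2 split: if_splits)
qed

lemma box_bump_le_indicator:
  assumes "\<epsilon> > 0"
  shows "\<bar>box_bump a b \<epsilon> 1 0 1 0 p\<bar> \<le> indicator (cbox a b) p"
proof -
  have "\<bar>interval_bump c d \<epsilon> 1 0 x\<bar> \<le> (if c < x \<and> x < d then 1 else 0)" for c d x
    using assms by (auto simp: interval_bump_def poly_interval_poly)
  then have "\<bar>box_bump a b \<epsilon> 1 0 1 0 p\<bar> \<le>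
      (if a$1 < p$1 \<and> p$1 < b$1 then 1 else 0) * (if a$2 < p$2 \<and> p$2 < b$2 then 1 else 0)"
    unfolding box_bump_def abs_mult by (intro mult_mono) auto
  also have "\<dots> \<le> indicator (cbox a b) p"
    by (auto simp: indicator_def mem_box_cart forall_2)
  finally show ?thesis .
qed

section \<open>Uniqueness of weak derivatives\<close>

text \<open>The positive and the negative part of \<open>f\<close> are densities of two finite measures that agree on open
  boxes. Boxes form an intersection-stable generator of the Borel sets, so the measures coincide,
  and the densities coincide almost everywhere.\<close>

lemma integrable_AE_zero_boxes_lborel:
  fixes f :: "'a::euclidean_space \<Rightarrow> real"
  assumes f: "integrable lborel f"
    and zero: "\<And>a b. (\<integral>x. indicator (box a b) x * f x \<partial>lborel) = 0"
  shows "AE x in lborel. f x = 0"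
proof -
  have [measurable]: "f \<in> borel_measurable borel"
    using borel_measurable_integrable[OF f] by simp
  have fin: "(\<integral>\<^sup>+x. ennreal (f x) \<partial>lborel) < \<infinity>"
    using f by (simp add: real_integrable_def less_top)
  have eq: "emeasure (density lborel (\<lambda>x. ennreal (f x))) (box a b) =
            emeasure (density lborel (\<lambda>x. ennreal (- f x))) (box a b)" for a b
  proof -
    let ?g = "\<lambda>x. indicator (box a b) x * f x"
    have g: "integrable lborel ?g"
      using integrable_real_mult_indicator[of "box a b" lborel f] f by (simp add: mult.commute)
    have split: "(\<integral>\<^sup>+x. ennreal (?g x) \<partial>lborel) < \<infinity>" "(\<integral>\<^sup>+x. ennreal (- ?g x) \<partial>lborel) < \<infinity>"
      using g by (simp_all add: real_integrable_def less_top)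
    have "enn2real (\<integral>\<^sup>+x. ennreal (?g x) \<partial>lborel) = enn2real (\<integral>\<^sup>+x. ennreal (- ?g x) \<partial>lborel)"
      using real_lebesgue_integral_def[OF g] zero[of a b] by simp
    then have "(\<integral>\<^sup>+x. ennreal (?g x) \<partial>lborel) = (\<integral>\<^sup>+x. ennreal (- ?g x) \<partial>lborel)"
      using split by (metis ennreal_enn2real infinity_ennreal_def)
    moreover have "(\<integral>\<^sup>+x. ennreal (f x) * indicator (box a b) x \<partial>lborel) = (\<integral>\<^sup>+x. ennreal (?g x) \<partial>lborel)"
      by (intro nn_integral_cong) (simp add: indicator_def)
    moreover have "(\<integral>\<^sup>+x. ennreal (- f x) * indicator (box a b) x \<partial>lborel) = (\<integral>\<^sup>+x. ennreal (- ?g x) \<partial>lborel)"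
      by (intro nn_integral_cong) (simp add: indicator_def)
    ultimately show ?thesis by (simp add: emeasure_density)
  qed
  have "density lborel (\<lambda>x. ennreal (f x)) = density lborel (\<lambda>x. ennreal (- f x))" (is "?M = ?N")
  proof (rule measure_eqI_generator_eq)
    let ?E = "range (\<lambda>(a, b). box a b::'a set)"
    let ?A = "\<lambda>n::nat. box (- (real n *\<^sub>R One)) (real n *\<^sub>R One) :: 'a set"
    show "Int_stable ?E" by (auto simp: Int_stable_def box_Int_box)
    show "?E \<subseteq> Pow UNIV" "sets ?M = sigma_sets UNIV ?E" "sets ?N = sigma_sets UNIV ?E"
      by (simp_all add: borel_eq_box)
    show "range ?A \<subseteq> ?E" "(\<Union>i. ?A i) = UNIV" unfolding UN_box_eq_UNIV by auto
    show "emeasure ?M X = emeasure ?N X" if "X \<in> ?E" for X using that eq by auto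
    show "emeasure ?M (?A i) \<noteq> \<infinity>" for i
    proof -
      have "emeasure ?M (?A i) = (\<integral>\<^sup>+x. ennreal (f x) * indicator (?A i) x \<partial>lborel)"
        by (simp add: emeasure_density)
      also have "\<dots> \<le> (\<integral>\<^sup>+x. ennreal (f x) \<partial>lborel)"
        by (intro nn_integral_mono) (simp add: indicator_def)
      finally show ?thesis using fin by (auto simp: top_unique)
    qed
  qed
  \<comment> \<open>The embedding into the nonnegative extended reals truncates at zero, so the two sides are the
    positive and the negative part of \<open>f x\<close>; at most one of them is nonzero.\<close>
  then have "AE x in lborel. ennreal (f x) = ennreal (- f x)"
    by (intro sigma_finite_measure.density_unique[OF sigma_finite_lborel]) auto
  then show ?thesis
  proof eventually_elim
    case (elim x)
    then show ?case
      by (cases "f x" "0::real" rule: linorder_cases) (auto simp: ennreal_neg)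
  qed
qed

lemma integrable_AE_zero_boxes:
  fixes f :: "'a::euclidean_space \<Rightarrow> real"
  assumes f: "integrable lebesgue f"
    and zero: "\<And>a b. (\<integral>x. indicator (box a b) x * f x \<partial>lebesgue) = 0"
  shows "AE x in lebesgue. f x = 0"
proof -
  obtain g where g [measurable]: "g \<in> borel_measurable lborel" and fg: "AE x in lborel. f x = g x"
    using completion_ex_borel_measurable_real[OF borel_measurable_integrable[OF f]] by auto
  have fg': "AE x in lebesgue. f x = g x" using fg by (rule AE_completion)
  have gm: "g \<in> borel_measurable lebesgue" using g by (rule measurable_completion)
  have fm: "f \<in> borel_measurable lebesgue" using f by simp
  have "integrable lebesgue g"
    using f fg' gm by (subst integrable_cong_AE[of g lebesgue f]) (auto simp: eq_commute)
  then have gi: "integrable lborel g" by (simp add: integrable_completion)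
  have "(\<integral>x. indicator (box a b) x * g x \<partial>lborel) = 0" for a b
  proof -
    have "(\<integral>x. indicator (box a b) x * g x \<partial>lborel) = (\<integral>x. indicator (box a b) x * g x \<partial>lebesgue)"
      by (rule integral_completion[symmetric]) measurable
    also have "\<dots> = (\<integral>x. indicator (box a b) x * f x \<partial>lebesgue)"
      using fg' fm gm by (intro integral_cong_AE borel_measurable_times borel_measurable_indicator) auto
    finally show ?thesis using zero by simp
  qed
  then have "AE x in lborel. g x = 0" by (rule integrable_AE_zero_boxes_lborel[OF gi])
  then have "AE x in lborel. f x = 0" using fg by eventually_elim simp
  then show ?thesis by (rule AE_completion)
qed

text \<open>The partial derivatives of a test function live on the same compact set as the function itself,
  which makes the integrals in the definition of a weak derivative finite for integrands that are
  only locally integrable.\<close>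

lemma test_function_support:
  assumes "test_function \<Omega> \<phi>"
  obtains K where "compact K" "K \<subseteq> \<Omega>" "\<And>p. p \<notin> K \<Longrightarrow> \<phi> p = 0" "\<And>i p. p \<notin> K \<Longrightarrow> partial_deriv i \<phi> p = 0"
proof
  let ?K = "closure {p. \<phi> p \<noteq> 0}"
  show "compact ?K" "?K \<subseteq> \<Omega>" using assms by (auto simp: test_function_def)
  show off: "\<phi> p = 0" if "p \<notin> ?K" for p
    using that closure_subset[of "{p. \<phi> p \<noteq> 0}"] by blast
  show "partial_deriv i \<phi> p = 0" if "p \<notin> ?K" for i p
  proof -
    have "((\<lambda>_. 0::real) has_derivative (\<lambda>_. 0)) (at p)" by simp
    then have "(\<phi> has_derivative (\<lambda>_. 0)) (at p)"
    proof (rule has_derivative_transform_within_open)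
      show "open (- ?K)" by (simp add: open_Compl)
      show "p \<in> - ?K" using that by simp
      show "0 = \<phi> x" if "x \<in> - ?K" for x using off[of x] that by simp
    qed
    then have "frechet_derivative \<phi> (at p) = (\<lambda>_. 0)" by (rule frechet_derivative_at[symmetric])
    then show ?thesis by (simp add: partial_deriv_def)
  qed
qed

lemma test_function_continuous:
  assumes "test_function \<Omega> \<phi>"
  shows "continuous_on UNIV \<phi>" "continuous_on UNIV (partial_deriv i \<phi>)"
proof -
  have "foldr partial_deriv [] \<phi> differentiable (at p)" for p
    using assms unfolding test_function_def by blast
  then show "continuous_on UNIV \<phi>"
    by (simp add: continuous_at_imp_continuous_on differentiable_imp_continuous_within)
  have "foldr partial_deriv [i] \<phi> differentiable (at p)" for p
    using assms unfolding test_function_def by blast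
  then show "continuous_on UNIV (partial_deriv i \<phi>)"
    by (simp add: continuous_at_imp_continuous_on differentiable_imp_continuous_within)
qed

lemma locally_integrable_times_compactly_supported:
  assumes h: "locally_integrable_on h \<Omega>" and \<phi>: "continuous_on UNIV \<phi>"
    and K: "compact K" "K \<subseteq> \<Omega>" "\<And>p. p \<notin> K \<Longrightarrow> \<phi> p = 0"
  shows "set_integrable lebesgue \<Omega> (\<lambda>p. h p * \<phi> p)"
proof -
  have "(\<lambda>p. \<phi> p * h p) absolutely_integrable_on K"
  proof (rule absolutely_integrable_bounded_measurable_product[OF bilinear_times])
    show "\<phi> \<in> borel_measurable (lebesgue_on K)"
      using continuous_on_subset[OF \<phi>] K(1)
      by (intro continuous_imp_measurable_on_sets_lebesgue) (auto simp: lmeasurable_compact fmeasurableD)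
    show "K \<in> sets lebesgue" using K(1) by (simp add: lmeasurable_compact fmeasurableD)
    show "bounded (\<phi> ` K)"
      using continuous_on_subset[OF \<phi>] K(1) by (intro compact_imp_bounded compact_continuous_image) auto
    show "h absolutely_integrable_on K" using h K by (auto simp: locally_integrable_on_def)
  qed
  moreover have "(\<lambda>p. indicator K p *\<^sub>R (\<phi> p * h p)) = (\<lambda>p. indicator \<Omega> p *\<^sub>R (h p * \<phi> p))"
    using K by (auto simp: indicator_def fun_eq_iff)
  ultimately show ?thesis unfolding set_integrable_def by simp
qed

text \<open>The difference of two weak derivatives integrates to zero against every bump on a rectangle, hence,
  by dominated convergence, over every open rectangle inside \<open>cbox a b\<close>.\<close>

lemma has_weak_partial_AE_unique_on_cbox:
  assumes h: "has_weak_partial \<Omega> i g h" and k: "has_weak_partial \<Omega> i g k" and B: "cbox a b \<subseteq> \<Omega>"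
  shows "AE p in lebesgue. p \<in> cbox a b \<longrightarrow> h p = k p"
proof -
  let ?f = "\<lambda>p. indicator (cbox a b) p * (h p - k p)"
  have hi: "h absolutely_integrable_on cbox a b" and ki: "k absolutely_integrable_on cbox a b"
    using h k B by (auto simp: has_weak_partial_def locally_integrable_on_def)
  have fi: "integrable lebesgue ?f"
    using set_integral_diff(1)[OF hi ki] by (simp add: set_integrable_def)
  have "(\<integral>p. indicator (box c d) p * ?f p \<partial>lebesgue) = 0" for c d
  proof -
    \<comment> \<open>The rectangle \<open>box l u\<close> is the intersection of \<open>box a b\<close> and \<open>box c d\<close>.\<close>
    define l u where "l = (\<chi> j. max (a $ j) (c $ j))" and "u = (\<chi> j. min (b $ j) (d $ j))"
    have lu: "cbox l u \<subseteq> cbox a b" "box l u \<subseteq> box c d \<inter> cbox a b"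
        "box c d \<inter> box a b \<subseteq> box l u"
      by (auto simp: l_def u_def mem_box_cart) (meson less_imp_le)+
    let ?\<phi> = "\<lambda>n. box_bump l u (inverse (real (Suc n))) 1 0 1 0"
    have \<phi>: "test_function \<Omega> (?\<phi> n)" for n
      using B lu(1) by (intro test_function_box_bump) auto
    have int0: "(\<integral>p. ?f p * ?\<phi> n p \<partial>lebesgue) = 0" for n
    proof -
      obtain K where K: "compact K" "K \<subseteq> \<Omega>" "\<And>p. p \<notin> K \<Longrightarrow> ?\<phi> n p = 0"
        using test_function_support[OF \<phi>[of n]] by metis
      have "set_integrable lebesgue \<Omega> (\<lambda>p. h p * ?\<phi> n p)" "set_integrable lebesgue \<Omega> (\<lambda>p. k p * ?\<phi> n p)"
        using h k test_function_continuous(1)[OF \<phi>] K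
        by (auto intro!: locally_integrable_times_compactly_supported simp: has_weak_partial_def)
      moreover have "(LINT p:\<Omega>|lebesgue. h p * ?\<phi> n p) = (LINT p:\<Omega>|lebesgue. k p * ?\<phi> n p)"
      proof -
        have "(LINT p:\<Omega>|lebesgue. g p * partial_deriv i (?\<phi> n) p) = - (LINT p:\<Omega>|lebesgue. h p * ?\<phi> n p)"
          "(LINT p:\<Omega>|lebesgue. g p * partial_deriv i (?\<phi> n) p) = - (LINT p:\<Omega>|lebesgue. k p * ?\<phi> n p)"
          using h k \<phi>[of n] unfolding has_weak_partial_def by blast+
        then show ?thesis by linarith
      qed
      ultimately have "(LINT p:\<Omega>|lebesgue. h p * ?\<phi> n p - k p * ?\<phi> n p) = 0"
        by (simp add: set_integral_diff)
      moreover have "indicator \<Omega> p *\<^sub>R (h p * ?\<phi> n p - k p * ?\<phi> n p) = ?f p * ?\<phi> n p" for p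
      proof (cases "p \<in> cbox a b")
        case True
        then show ?thesis using B by (auto simp: algebra_simps)
      next
        case False
        then have "p \<notin> cbox l u" using lu(1) by blast
        then have "?\<phi> n p = 0"
          using box_bump_le_indicator[of "inverse (real (Suc n))" l u p] by simp
        then show ?thesis by simp
      qed
      ultimately show ?thesis unfolding set_lebesgue_integral_def by simp
    qed
    have "(\<lambda>n. \<integral>p. ?f p * ?\<phi> n p \<partial>lebesgue) \<longlonglongrightarrow> (\<integral>p. indicator (box c d) p * ?f p \<partial>lebesgue)"
    proof (rule integral_dominated_convergence)
      show "integrable lebesgue (\<lambda>p. norm (?f p))" using fi by (rule integrable_norm)
      show "(\<lambda>p. indicator (box c d) p * ?f p) \<in> borel_measurable lebesgue"
        by (intro borel_measurable_times borel_measurable_indicator borel_measurable_integrable[OF fi]) simp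
      show "(\<lambda>p. ?f p * ?\<phi> n p) \<in> borel_measurable lebesgue" for n
      proof -
        have "?\<phi> n \<in> borel_measurable lebesgue"
          using test_function_continuous(1)[OF \<phi>] continuous_imp_measurable_on_sets_lebesgue[of UNIV]
          by (auto simp: lebesgue_on_UNIV_eq)
        then show ?thesis using borel_measurable_integrable[OF fi] by (rule borel_measurable_times[rotated])
      qed
      show "AE p in lebesgue. norm (?f p * ?\<phi> n p) \<le> norm (?f p)" for n
      proof (rule AE_I2)
        fix p
        have "\<bar>?\<phi> n p\<bar> \<le> indicator (cbox l u) p" by (rule box_bump_le_indicator) simp
        also have "\<dots> \<le> 1" by (simp add: indicator_def)
        finally have "\<bar>?f p\<bar> * \<bar>?\<phi> n p\<bar> \<le> \<bar>?f p\<bar> * 1" by (rule mult_left_mono) simp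
        then show "norm (?f p * ?\<phi> n p) \<le> norm (?f p)" by (simp add: abs_mult)
      qed
      have "AE p in lebesgue. p \<notin> cbox a b - box a b"
        using negligible_frontier_interval[of a b]
        by (intro AE_not_in) (simp add: negligible_iff_null_sets)
      then show "AE p in lebesgue. (\<lambda>n. ?f p * ?\<phi> n p) \<longlonglongrightarrow> indicator (box c d) p * ?f p"
      proof eventually_elim
        case (elim p)
        have "(\<lambda>n. ?f p * ?\<phi> n p) \<longlonglongrightarrow> ?f p * indicator (box l u) p"
          by (intro tendsto_intros box_bump_tendsto_indicator)
        moreover have "?f p * indicator (box l u) p = indicator (box c d) p * ?f p"
        proof (cases "p \<in> cbox a b")
          case True
          then have "p \<in> box l u \<longleftrightarrow> p \<in> box c d" using elim lu by blast
          then show ?thesis by (simp add: indicator_def)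
        qed simp
        ultimately show ?case by simp
      qed
    qed
    then show ?thesis unfolding int0 using LIMSEQ_unique tendsto_const by blast
  qed
  then have "AE p in lebesgue. ?f p = 0" by (rule integrable_AE_zero_boxes[OF fi])
  then show ?thesis by eventually_elim auto
qed

text \<open>Uniqueness of weak derivatives: an open set is a countable union of closed boxes. It is what
  identifies the arbitrarily chosen representative in the roughness with a gradient known
  explicitly.\<close>

lemma has_weak_partial_AE_unique:
  assumes "open \<Omega>" and h: "has_weak_partial \<Omega> i g h" and k: "has_weak_partial \<Omega> i g k"
  shows "AE p in lebesgue. p \<in> \<Omega> \<longrightarrow> h p = k p"
proof -
  obtain D where D: "countable D" "\<And>X. X \<in> D \<Longrightarrow> X \<subseteq> \<Omega>" "\<And>X. X \<in> D \<Longrightarrow> \<exists>a b. X = cbox a b"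
      and cover: "\<Union>D = \<Omega>"
    using open_countable_Union_open_cbox[OF assms(1)] by (metis Pow_iff subset_iff)
  have "AE p in lebesgue. p \<in> X \<longrightarrow> h p = k p" if "X \<in> D" for X
    using D(2,3)[OF that] has_weak_partial_AE_unique_on_cbox[OF h k] by blast
  then have "AE p in lebesgue. \<forall>X\<in>D. p \<in> X \<longrightarrow> h p = k p"
    by (intro AE_ball_countable'[OF _ D(1)])
  then show ?thesis by eventually_elim (use cover in auto)
qed

section \<open>Weak derivatives of Lipschitz functions\<close>

lemma test_function_partial_deriv:
  assumes "test_function \<Omega> \<phi>"
  shows "((\<lambda>s. \<phi> (p + s *\<^sub>R axis i 1)) has_real_derivative partial_deriv i \<phi> (p + s *\<^sub>R axis i 1)) (at s)"
proof -
  have "foldr partial_deriv [] \<phi> differentiable (at (p + s *\<^sub>R axis i 1))"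
    using assms unfolding test_function_def by blast
  then have D: "(\<phi> has_derivative frechet_derivative \<phi> (at (p + s *\<^sub>R axis i 1))) (at (p + s *\<^sub>R axis i 1))"
    by (simp add: frechet_derivative_works)
  have "((\<lambda>s. p + s *\<^sub>R axis i 1) has_derivative (\<lambda>t. t *\<^sub>R axis i 1)) (at s)"
    by (auto intro!: derivative_eq_intros)
  from has_derivative_compose[OF this D]
  have "((\<lambda>s. \<phi> (p + s *\<^sub>R axis i 1)) has_derivative
        (\<lambda>t. frechet_derivative \<phi> (at (p + s *\<^sub>R axis i 1)) (t *\<^sub>R axis i 1))) (at s)" .
  moreover have "(\<lambda>t. frechet_derivative \<phi> (at (p + s *\<^sub>R axis i 1)) (t *\<^sub>R axis i 1)) =
      (*) (partial_deriv i \<phi> (p + s *\<^sub>R axis i 1))"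
    using linear_cmul[OF has_derivative_linear[OF D]]
    by (simp add: fun_eq_iff partial_deriv_def mult.commute)
  ultimately show ?thesis by (simp add: has_field_derivative_def)
qed

text \<open>Along a coordinate direction the mean value theorem bounds the increments by the maximum of a
  continuous, compactly supported partial derivative.\<close>

lemma test_function_Lipschitz:
  assumes \<phi>: "test_function \<Omega> \<phi>"
  obtains M where "M \<ge> 0" "\<And>p. \<bar>\<phi> p\<bar> \<le> M"
    "\<And>p s. \<bar>\<phi> (p + s *\<^sub>R axis i 1) - \<phi> p\<bar> \<le> M * \<bar>s\<bar>"
proof -
  obtain K where K: "compact K" "\<And>p. p \<notin> K \<Longrightarrow> \<phi> p = 0" "\<And>i p. p \<notin> K \<Longrightarrow> partial_deriv i \<phi> p = 0"
    using test_function_support[OF \<phi>] by metis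
  have bound: "\<exists>B>0. \<forall>p. \<bar>f p\<bar> \<le> B" if "continuous_on UNIV f" "\<And>p. p \<notin> K \<Longrightarrow> f p = 0" for f :: "real^2 \<Rightarrow> real"
  proof -
    have "bounded (f ` K)"
      using continuous_on_subset[OF that(1)] K(1) by (intro compact_imp_bounded compact_continuous_image) auto
    then obtain B where B: "B > 0" "\<And>p. p \<in> K \<Longrightarrow> \<bar>f p\<bar> \<le> B" unfolding bounded_pos by auto
    have "\<bar>f p\<bar> \<le> B" for p using B that(2)[of p] by (cases "p \<in> K") auto
    then show ?thesis using B(1) by blast
  qed
  obtain B where B: "B > 0" "\<And>p. \<bar>\<phi> p\<bar> \<le> B"
    using bound[OF test_function_continuous(1)[OF \<phi>]] K by metis
  obtain B' where B': "B' > 0" "\<And>p. \<bar>partial_deriv i \<phi> p\<bar> \<le> B'"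
    using bound[OF test_function_continuous(2)[OF \<phi>]] K by metis
  show thesis
  proof
    show "0 \<le> max B B'" using B by simp
    show "\<bar>\<phi> p\<bar> \<le> max B B'" for p using B(2)[of p] by simp
    show "\<bar>\<phi> (p + s *\<^sub>R axis i 1) - \<phi> p\<bar> \<le> max B B' * \<bar>s\<bar>" for p s
    proof -
      have "norm (\<phi> (p + s *\<^sub>R axis i 1) - \<phi> (p + 0 *\<^sub>R axis i 1)) \<le> B' * norm (s - 0)"
        using B'(2) DERIV_subset[OF test_function_partial_deriv[OF \<phi>]]
        by (intro field_differentiable_bound[of UNIV "\<lambda>s. \<phi> (p + s *\<^sub>R axis i 1)"]) auto
      also have "\<dots> \<le> max B B' * \<bar>s\<bar>" by (simp add: mult_right_mono)
      finally show ?thesis by simp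
    qed
  qed
qed

lemma lebesgue_integral_translation:
  fixes f :: "'a::euclidean_space \<Rightarrow> real"
  assumes "continuous_on UNIV f"
  shows "integral\<^sup>L lebesgue (\<lambda>p. f (p + d)) = integral\<^sup>L lebesgue f"
proof -
  have [measurable]: "f \<in> borel_measurable borel" using assms by (rule borel_measurable_continuous_onI)
  have "integral\<^sup>L lebesgue (\<lambda>p. f (p + d)) = integral\<^sup>L lborel (\<lambda>p. f (p + d))"
    by (rule integral_completion) measurable
  also have "\<dots> = integral\<^sup>L (distr lborel borel ((+) d)) f"
    by (subst integral_distr) (auto simp: add.commute)
  also have "\<dots> = integral\<^sup>L lborel f" by (simp add: lborel_distr_plus)
  also have "\<dots> = integral\<^sup>L lebesgue f" by (rule integral_completion[symmetric]) measurable
  finally show ?thesis .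
qed

lemma continuous_locally_integrable:
  assumes "continuous_on UNIV g"
  shows "locally_integrable_on g \<Omega>"
  unfolding locally_integrable_on_def
proof (intro allI impI, elim conjE)
  fix K :: "(real^2) set" assume K: "compact K"
  have "integrable lborel (\<lambda>p. indicator K p *\<^sub>R g p)"
    using K continuous_on_subset[OF assms] by (intro borel_integrable_compact) auto
  then show "g absolutely_integrable_on K"
    unfolding set_integrable_def by (subst integrable_completion) auto
qed

text \<open>For a test function \<open>\<phi>\<close>, the product \<open>\<psi> = g \<phi>\<close> is integrable, so by translation invariance every
  difference quotient of \<open>\<psi>\<close> has integral zero. The Lipschitz conditions bound the quotients
  uniformly, and they converge almost everywhere to \<open>h \<phi> + g \<partial>\<phi>\<close>. Dominated convergence therefore
  gives integration by parts without Fubini's theorem and without boundary terms.\<close>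

lemma Lipschitz_has_weak_partial:
  fixes g h :: "real^2 \<Rightarrow> real"
  assumes lip: "L-lipschitz_on UNIV g"
    and h: "locally_integrable_on h \<Omega>"
    and deriv: "AE p in lebesgue. p \<in> \<Omega> \<longrightarrow>
       ((\<lambda>s. g (p + s *\<^sub>R axis i 1)) has_real_derivative h p) (at 0)"
  shows "has_weak_partial \<Omega> i g h"
proof -
  have g: "continuous_on UNIV g" using lip by (rule lipschitz_on_continuous_on)
  have gloc: "locally_integrable_on g \<Omega>"
    using g by (rule continuous_locally_integrable)
  have "(LINT p:\<Omega>|lebesgue. g p * partial_deriv i \<phi> p) = - (LINT p:\<Omega>|lebesgue. h p * \<phi> p)"
    if \<phi>: "test_function \<Omega> \<phi>" for \<phi>
  proof -
    let ?e = "axis i 1 :: real^2"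
    obtain K where K: "compact K" "K \<subseteq> \<Omega>" "\<And>p. p \<notin> K \<Longrightarrow> \<phi> p = 0"
        "\<And>i p. p \<notin> K \<Longrightarrow> partial_deriv i \<phi> p = 0"
      using test_function_support[OF \<phi>] by metis
    obtain M where M: "M \<ge> 0" "\<And>p. \<bar>\<phi> p\<bar> \<le> M" "\<And>p s. \<bar>\<phi> (p + s *\<^sub>R ?e) - \<phi> p\<bar> \<le> M * \<bar>s\<bar>"
      using test_function_Lipschitz[OF \<phi>, of i] by metis
    define \<psi> where "\<psi> p = g p * \<phi> p" for p
    have \<psi>: "continuous_on UNIV \<psi>"
      unfolding \<psi>_def by (intro continuous_intros g test_function_continuous(1)[OF \<phi>])
    obtain r where r: "r > 0" "K \<subseteq> cball 0 r"
      using bounded_subset_ballD[OF compact_imp_bounded[OF K(1)], of 0] ball_subset_cball by blast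
    \<comment> \<open>The support of \<open>\<phi>\<close> lies in the ball of radius \<open>r\<close>. Steps have length at most one, so both end
      points of any step that meets the support lie in \<open>R\<close>.\<close>
    define R where "R = cball (0::real^2) (r + 2)"
    have "bounded (g ` R)"
      unfolding R_def using continuous_on_subset[OF g] by (intro compact_imp_bounded compact_continuous_image) auto
    then obtain B where B: "B > 0" "\<And>p. p \<in> R \<Longrightarrow> \<bar>g p\<bar> \<le> B" unfolding bounded_pos by auto
    have L: "L \<ge> 0" using lip by (rule lipschitz_on_nonneg)
    define s where "s n = inverse (real (Suc n))" for n
    have s: "s n > 0" "s n \<le> 1" for n by (auto simp: s_def field_simps)
    have s0: "s \<longlonglongrightarrow> 0" unfolding s_def by (rule LIMSEQ_inverse_real_of_nat)
    define D where "D n p = (\<psi> (p + s n *\<^sub>R ?e) - \<psi> p) / s n" for n p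
    define d where "d p = h p * \<phi> p + g p * partial_deriv i \<phi> p" for p
    have e1: "norm ?e = 1" by simp
    have hphi: "set_integrable lebesgue \<Omega> (\<lambda>p. h p * \<phi> p)"
      using locally_integrable_times_compactly_supported[OF h test_function_continuous(1)[OF \<phi>] K(1-3)] .
    have gphi: "set_integrable lebesgue \<Omega> (\<lambda>p. g p * partial_deriv i \<phi> p)"
      using locally_integrable_times_compactly_supported[OF gloc test_function_continuous(2)[OF \<phi>] K(1-2) K(4)] .
    have dint: "set_integrable lebesgue \<Omega> d" unfolding d_def using hphi gphi by (rule set_integral_add)
    have D_cont: "continuous_on UNIV (D n)" for n
      unfolding D_def using s[of n]
      by (intro continuous_intros continuous_on_compose2[OF \<psi>]) auto
    have bound: "\<bar>D n p\<bar> \<le> (B * M + M * L) * indicator R p" for n p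
    proof (cases "p \<in> K \<or> p + s n *\<^sub>R ?e \<in> K")
      case True
      have p: "p + s n *\<^sub>R ?e \<in> R" "p \<in> R"
      proof -
        have n1: "norm (s n *\<^sub>R ?e) \<le> 1" using s[of n] e1 by simp
        have "norm p \<le> r + 1"
          using True
        proof
          assume "p \<in> K"
          then show ?thesis using r by (auto simp: subset_iff)
        next
          assume "p + s n *\<^sub>R ?e \<in> K"
          then have "norm (p + s n *\<^sub>R ?e) \<le> r" using r by (auto simp: subset_iff)
          then show ?thesis using n1 norm_triangle_ineq4[of "p + s n *\<^sub>R ?e" "s n *\<^sub>R ?e"] by simp
        qed
        then show "p + s n *\<^sub>R ?e \<in> R" "p \<in> R"
          using n1 norm_triangle_ineq[of p "s n *\<^sub>R ?e"] by (auto simp: R_def)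
      qed
      have "\<bar>g (p + s n *\<^sub>R ?e) - g p\<bar> \<le> L * s n"
        using lipschitz_onD[OF lip, of "p + s n *\<^sub>R ?e" p] s[of n] e1 by (simp add: dist_norm)
      then have 2: "\<bar>\<phi> p\<bar> * \<bar>g (p + s n *\<^sub>R ?e) - g p\<bar> \<le> M * (L * s n)"
        using M by (intro mult_mono) auto
      have 1: "\<bar>g (p + s n *\<^sub>R ?e)\<bar> * \<bar>\<phi> (p + s n *\<^sub>R ?e) - \<phi> p\<bar> \<le> B * (M * s n)"
        using B(2)[OF p(1)] B(1) M(3)[of p "s n"] s[of n] by (intro mult_mono) auto
      \<comment> \<open>The product rule for increments bounds the increment of \<open>\<psi>\<close> by a multiple of the step.\<close>
      have "\<psi> (p + s n *\<^sub>R ?e) - \<psi> p =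
          g (p + s n *\<^sub>R ?e) * (\<phi> (p + s n *\<^sub>R ?e) - \<phi> p) + \<phi> p * (g (p + s n *\<^sub>R ?e) - g p)"
        by (simp add: \<psi>_def algebra_simps)
      then have "\<bar>\<psi> (p + s n *\<^sub>R ?e) - \<psi> p\<bar> \<le> B * (M * s n) + M * (L * s n)"
        using 1 2 abs_triangle_ineq[of "g (p + s n *\<^sub>R ?e) * (\<phi> (p + s n *\<^sub>R ?e) - \<phi> p)"
            "\<phi> p * (g (p + s n *\<^sub>R ?e) - g p)"] by (simp add: abs_mult)
      then have "\<bar>\<psi> (p + s n *\<^sub>R ?e) - \<psi> p\<bar> \<le> (B * M + M * L) * s n" by (simp add: algebra_simps)
      then show ?thesis using s[of n] p by (simp add: D_def abs_divide pos_divide_le_eq)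
    next
      case False
      then show ?thesis using B(1) M(1) L by (simp add: D_def \<psi>_def K(3))
    qed
    have "integrable lebesgue (indicator R :: real^2 \<Rightarrow> real)"
      unfolding R_def by (intro integrable_real_indicator) (auto simp: emeasure_bounded_finite[unfolded infinity_ennreal_def])
    then have Rint: "integrable lebesgue (\<lambda>p. (B * M + M * L) * indicator R p)" by simp
    have pw: "AE p in lebesgue. (\<lambda>n. D n p) \<longlonglongrightarrow> indicator \<Omega> p * d p"
      using deriv
    proof eventually_elim
      case (elim p)
      have nz: "\<forall>\<^sub>F n in sequentially. s n \<noteq> 0" by (simp add: s_def)
      have s_at: "filterlim s (at 0) sequentially"
        using s0 nz by (auto simp: filterlim_at)
      show ?case
      proof (cases "p \<in> \<Omega>")
        case True
        then have "((\<lambda>t. g (p + t *\<^sub>R ?e)) has_real_derivative h p) (at 0)" using elim by simp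
        from DERIV_mult'[OF this test_function_partial_deriv[OF \<phi>, of p i 0]]
        have "((\<lambda>t. \<psi> (p + t *\<^sub>R ?e)) has_real_derivative d p) (at 0)"
          by (simp add: \<psi>_def d_def add.commute)
        then have "((\<lambda>t. (\<psi> (p + t *\<^sub>R ?e) - \<psi> p) / t) \<longlongrightarrow> d p) (at 0)"
          by (simp add: DERIV_def)
        from filterlim_compose[OF this s_at] show ?thesis using True by (simp add: D_def)
      next
        case False
        then have "p \<in> - K" "open (- K)" using K by (auto intro: compact_imp_closed)
        moreover have "(\<lambda>n. p + s n *\<^sub>R ?e) \<longlonglongrightarrow> p + 0 *\<^sub>R ?e" by (intro tendsto_intros s0)
        ultimately have "\<forall>\<^sub>F n in sequentially. p + s n *\<^sub>R ?e \<in> - K"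
          by (auto dest: topological_tendstoD)
        then have "\<forall>\<^sub>F n in sequentially. D n p = 0"
          by eventually_elim (use \<open>p \<in> - K\<close> in \<open>simp add: D_def \<psi>_def K(3)\<close>)
        then show ?thesis using False by (simp add: tendsto_eventually)
      qed
    qed
    have "(\<lambda>n. integral\<^sup>L lebesgue (D n)) \<longlonglongrightarrow> (\<integral>p. indicator \<Omega> p * d p \<partial>lebesgue)"
    proof (rule integral_dominated_convergence[OF _ _ Rint pw])
      show "(\<lambda>p. indicator \<Omega> p * d p) \<in> borel_measurable lebesgue"
        using dint by (auto simp: set_integrable_def)
      show "D n \<in> borel_measurable lebesgue" for n
        using D_cont[of n] by (intro measurable_completion) (simp add: borel_measurable_continuous_onI)
      show "AE p in lebesgue. norm (D n p) \<le> (B * M + M * L) * indicator R p" for n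
        using bound by simp
    qed
    moreover have "integral\<^sup>L lebesgue (D n) = 0" for n
    proof -
      \<comment> \<open>Splitting the integral of the quotient requires that both pieces be integrable; the translate of
        \<open>\<psi>\<close> is recovered from \<open>D n\<close> and \<open>\<psi>\<close>.\<close>
      have psi_int: "integrable lebesgue \<psi>"
      proof -
        have "set_integrable lebesgue UNIV (\<lambda>p. g p * \<phi> p)"
          using K by (intro locally_integrable_times_compactly_supported[where K = K]
              continuous_locally_integrable g test_function_continuous(1)[OF \<phi>]) auto
        then show ?thesis by (simp add: set_integrable_def \<psi>_def[abs_def])
      qed
      have D_int: "integrable lebesgue (D n)"
        using D_cont[of n]
        by (intro Bochner_Integration.integrable_bound[OF Rint])
          (auto intro!: measurable_completion borel_measurable_continuous_onI
                intro: order_trans[OF bound abs_ge_self])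
      have "integrable lebesgue (\<lambda>p. s n * D n p + \<psi> p)" using D_int psi_int by simp
      moreover have "(\<lambda>p. s n * D n p + \<psi> p) = (\<lambda>p. \<psi> (p + s n *\<^sub>R ?e))"
        using s[of n] by (simp add: D_def fun_eq_iff)
      ultimately have "integrable lebesgue (\<lambda>p. \<psi> (p + s n *\<^sub>R ?e))" by simp
      then have "integral\<^sup>L lebesgue (D n) =
          (integral\<^sup>L lebesgue (\<lambda>p. \<psi> (p + s n *\<^sub>R ?e)) - integral\<^sup>L lebesgue \<psi>) / s n"
        using psi_int by (simp add: D_def[abs_def])
      then show ?thesis by (simp add: lebesgue_integral_translation[OF \<psi>])
    qed
    ultimately have "(\<integral>p. indicator \<Omega> p * d p \<partial>lebesgue) = 0"
      by (simp add: LIMSEQ_const_iff)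
    then have "(LINT p:\<Omega>|lebesgue. d p) = 0" by (simp add: set_lebesgue_integral_def)
    then show ?thesis
      unfolding d_def using set_integral_add(2)[OF hphi gphi] by simp
  qed
  then show ?thesis using gloc h by (simp add: has_weak_partial_def)
qed

section \<open>Oriented area\<close>

text \<open>Twice the signed area of the triangle \<open>a, b, c\<close>, positive when the vertices run
  counterclockwise.\<close>

definition orient :: "real^2 \<Rightarrow> real^2 \<Rightarrow> real^2 \<Rightarrow> real" where
  "orient a b c = (b$1 - a$1) * (c$2 - a$2) - (b$2 - a$2) * (c$1 - a$1)"

text \<open>The vector \<open>b - a\<close> turned by a right angle, which is the gradient of \<open>orient a b\<close>.\<close>

definition side_normal :: "real^2 \<Rightarrow> real^2 \<Rightarrow> real^2" where
  "side_normal a b = vector [a$2 - b$2, b$1 - a$1]"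

lemma inner_2: "(x::real^2) \<bullet> y = x$1 * y$1 + x$2 * y$2"
  by (simp add: inner_vec_def sum_2)

lemma orient_eq_inner: "orient a b c = side_normal a b \<bullet> c - side_normal a b \<bullet> a"
  by (simp add: orient_def side_normal_def inner_2 vector_2 algebra_simps)

section \<open>Convex quadrilaterals\<close>

text \<open>A face of a convex set contains every point of the set in its affine hull, and both end points of
  any segment of the set whose interior it meets. The first property keeps \<open>r\<close> and \<open>s\<close> off the line
  through \<open>p\<close> and \<open>q\<close>. If they were on opposite sides, the segment between them would cross the line
  inside \<open>Q\<close>, and the second property would put \<open>r\<close> on the edge.\<close>

lemma edge_same_side:
  assumes edge: "closed_segment p q edge_of Q" and Q: "convex Q"
    and pts: "p \<noteq> q" "r \<in> Q" "s \<in> Q" "r \<notin> closed_segment p q" "s \<notin> closed_segment p q"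
  shows "orient p q r * orient p q s > 0"
proof (rule ccontr)
  assume neg: "\<not> orient p q r * orient p q s > 0"
  have face: "closed_segment p q face_of Q" using edge by (simp add: edge_of_def)
  have line: "x \<in> closed_segment p q" if "x \<in> Q" "orient p q x = 0" for x
  proof -
    define d where "d = q - p"
    have d: "d \<bullet> d > 0" using pts(1) by (simp add: d_def)
    \<comment> \<open>The coordinate of \<open>x\<close> on the line, measured from \<open>p\<close> in units of \<open>d = q - p\<close>.\<close>
    define t where "t = d \<bullet> (x - p) / (d \<bullet> d)"
    have cross: "d$1 * (x$2 - p$2) = d$2 * (x$1 - p$1)"
      using that(2) by (simp add: orient_def d_def)
    have "(d \<bullet> d) * (x$1 - p$1) = (d \<bullet> (x - p)) * d$1" "(d \<bullet> d) * (x$2 - p$2) = (d \<bullet> (x - p)) * d$2"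
      using cross by (simp_all add: inner_2) algebra+
    then have "x$1 = p$1 + t * d$1" "x$2 = p$2 + t * d$2"
      using d by (simp_all add: t_def field_simps)
    then have "x = (1 - t) *\<^sub>R p + t *\<^sub>R q"
      by (simp add: vec_eq_iff forall_2 d_def algebra_simps)
    then have "x \<in> affine hull {p, q}"
      unfolding affine_hull_2 by (intro CollectI exI[of _ "1 - t"] exI[of _ t]) simp
    moreover have "affine hull {p, q} \<subseteq> affine hull closed_segment p q"
      by (intro hull_mono) auto
    ultimately show ?thesis
      using face_of_imp_eq_affine_Int[OF Q face] that(1) by blast
  qed
  have nz: "orient p q r \<noteq> 0" "orient p q s \<noteq> 0" using line pts by blast+
  \<comment> \<open>The parameter at which the segment from \<open>r\<close> to \<open>s\<close> crosses the line.\<close>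
  define t where "t = orient p q r / (orient p q r - orient p q s)"
  have opp: "orient p q r < 0 \<and> 0 < orient p q s \<or> orient p q s < 0 \<and> 0 < orient p q r"
    using neg nz by (metis linorder_neqE_linordered_idom mult_neg_neg mult_pos_pos)
  then have t: "0 < t" "t < 1" by (auto simp: t_def divide_simps)
  define x where "x = (1 - t) *\<^sub>R r + t *\<^sub>R s"
  have "r \<noteq> s" using opp by auto
  then have xr: "x \<in> open_segment r s" using t by (auto simp: x_def in_segment)
  have "x \<in> Q" using convexD_alt[OF Q pts(2,3), of t] t by (simp add: x_def)
  moreover have "orient p q x = (1 - t) * orient p q r + t * orient p q s"
    by (simp add: x_def orient_eq_inner inner_add_right algebra_simps)
  then have "orient p q x = orient p q r - t * (orient p q r - orient p q s)"
    by (simp add: algebra_simps)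
  then have "orient p q x = 0" using opp by (auto simp: t_def)
  ultimately have "x \<in> closed_segment p q" by (rule line)
  then have "r \<in> closed_segment p q" using face_ofD[OF face xr pts(2,3)] by blast
  then show False using pts(4) by contradiction
qed

lemma extreme_point_not_in_segment:
  assumes "r extreme_point_of Q" "p \<in> Q" "q \<in> Q" "r \<noteq> p" "r \<noteq> q"
  shows "r \<notin> closed_segment p q"
  using assms unfolding extreme_point_of_def by (auto simp: open_segment_def)

text \<open>Both diagonals cut the quadrilateral into triangles of the same orientation. Up to cyclic rotation
  of the vertices there are only four orientations, and three of the edges already link all of them.
  The sign \<open>\<sigma>\<close> allows the vertices to run clockwise or counterclockwise.\<close>

lemma strictly_convex_quadrilateral_orient:
  assumes "strictly_convex_quadrilateral u1 u2 u3 u4"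
  obtains \<sigma> :: real where "\<bar>\<sigma>\<bar> = 1" "\<sigma> * orient u1 u2 u4 > 0" "\<sigma> * orient u2 u3 u4 > 0"
    "\<sigma> * orient u1 u2 u3 > 0" "\<sigma> * orient u1 u3 u4 > 0"
proof -
  define Q where "Q = convex hull {u1, u2, u3, u4}"
  have dist: "distinct [u1, u2, u3, u4]"
    and ext: "{p. p extreme_point_of Q} = {u1, u2, u3, u4}"
    and edges: "closed_segment u1 u2 edge_of Q" "closed_segment u2 u3 edge_of Q"
      "closed_segment u3 u4 edge_of Q" "closed_segment u4 u1 edge_of Q"
    using assms by (auto simp: strictly_convex_quadrilateral_def Let_def Q_def)
  have conv: "convex Q" by (simp add: Q_def)
  have inQ: "{u1, u2, u3, u4} \<subseteq> Q" unfolding Q_def by (rule hull_subset)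
  have out: "r \<notin> closed_segment p q"
    if "r \<in> {u1, u2, u3, u4}" "p \<in> {u1, u2, u3, u4}" "q \<in> {u1, u2, u3, u4}" "r \<noteq> p" "r \<noteq> q" for p q r
    using that ext inQ by (intro extreme_point_not_in_segment[of r Q]) auto
  have 1: "orient u1 u2 u3 * orient u1 u2 u4 > 0"
    using dist inQ by (intro edge_same_side[OF edges(1) conv] out) auto
  have 2: "orient u2 u3 u4 * orient u2 u3 u1 > 0"
    using dist inQ by (intro edge_same_side[OF edges(2) conv] out) auto
  have 3: "orient u3 u4 u1 * orient u3 u4 u2 > 0"
    using dist inQ by (intro edge_same_side[OF edges(3) conv] out) auto
  have cyc: "orient u2 u3 u1 = orient u1 u2 u3" "orient u3 u4 u1 = orient u1 u3 u4"
      "orient u3 u4 u2 = orient u2 u3 u4"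
    by (simp_all add: orient_def algebra_simps)
  show thesis
    using 1 2 3 that[of "sgn (orient u1 u2 u3)"]
    unfolding cyc by (auto simp: zero_less_mult_iff sgn_if)
qed

section \<open>The circumcircle criterion and the energy comparison\<close>

lemma metric_sqdist_metric_matrix:
  "metric_sqdist (metric_matrix cv) p q = (q$1 - p$1)\<^sup>2 + cv\<^sup>2 * (q$2 - p$2)\<^sup>2"
  by (simp add: metric_sqdist_def metric_matrix_def inner_2 matrix_vector_mult_def sum_2 vector_2 power2_eq_square)

text \<open>Subtracting the conditions of equal distance removes the quadratic terms. What remains is a linear
  system with determinant proportional to \<open>orient a b c\<close>, so the equidistant point exists and is
  unique.\<close>

lemma metric_circumcenter_equidistant:
  assumes nz: "orient a b c \<noteq> 0" "cv \<noteq> 0"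
  defines "M \<equiv> metric_matrix cv"
  shows "metric_sqdist M a (metric_circumcenter M a b c) = metric_sqdist M b (metric_circumcenter M a b c)"
    and "metric_sqdist M b (metric_circumcenter M a b c) = metric_sqdist M c (metric_circumcenter M a b c)"
proof -
  let ?N = "\<lambda>p::real^2. (p$1 - a$1)\<^sup>2 + cv\<^sup>2 * (p$2 - a$2)\<^sup>2"
  let ?P = "\<lambda>z. metric_sqdist M a z = metric_sqdist M b z \<and> metric_sqdist M b z = metric_sqdist M c z"
  let ?lin = "\<lambda>z p. 2 * ((p$1 - a$1) * (z$1 - a$1) + cv\<^sup>2 * (p$2 - a$2) * (z$2 - a$2)) = ?N p"
  have lin: "?P z \<longleftrightarrow> ?lin z b \<and> ?lin z c" for z
    unfolding M_def metric_sqdist_metric_matrix by (auto simp: power2_eq_square algebra_simps)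
  define o' where "o' = orient a b c"
  \<comment> \<open>The solution by Cramer's rule.\<close>
  define z :: "real^2" where "z = vector
     [a$1 + (?N b * (c$2 - a$2) - ?N c * (b$2 - a$2)) / (2 * o'),
      a$2 + (?N c * (b$1 - a$1) - ?N b * (c$1 - a$1)) / (2 * cv\<^sup>2 * o')]"
  have o': "o' \<noteq> 0" "o' = (b$1 - a$1) * (c$2 - a$2) - (b$2 - a$2) * (c$1 - a$1)"
    using nz by (simp_all add: o'_def orient_def)
  have z: "2 * o' * (z$1 - a$1) = ?N b * (c$2 - a$2) - ?N c * (b$2 - a$2)"
      "2 * o' * (cv\<^sup>2 * (z$2 - a$2)) = ?N c * (b$1 - a$1) - ?N b * (c$1 - a$1)"
    using o'(1) nz(2) by (simp_all add: z_def vector_2)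
  have cramer: "o' * (2 * ((p$1 - a$1) * (z$1 - a$1) + cv\<^sup>2 * (p$2 - a$2) * (z$2 - a$2))) =
      (p$1 - a$1) * (?N b * (c$2 - a$2) - ?N c * (b$2 - a$2)) +
      (p$2 - a$2) * (?N c * (b$1 - a$1) - ?N b * (c$1 - a$1))" for p :: "real^2"
    unfolding z[symmetric] by (simp add: algebra_simps)
  have "o' * (2 * ((b$1 - a$1) * (z$1 - a$1) + cv\<^sup>2 * (b$2 - a$2) * (z$2 - a$2))) = o' * ?N b"
      "o' * (2 * ((c$1 - a$1) * (z$1 - a$1) + cv\<^sup>2 * (c$2 - a$2) * (z$2 - a$2))) = o' * ?N c"
    unfolding cramer unfolding o'(2) by algebra+
  then have Pz: "?P z" using o'(1) unfolding lin by simp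
  have "z' = z" if "?P z'" for z'
  proof -
    define d1 d2 where "d1 = z'$1 - z$1" and "d2 = cv\<^sup>2 * (z'$2 - z$2)"
    have "?lin z b" "?lin z c" "?lin z' b" "?lin z' c" using Pz that unfolding lin by blast+
    then have "(b$1 - a$1) * d1 + (b$2 - a$2) * d2 = 0" "(c$1 - a$1) * d1 + (c$2 - a$2) * d2 = 0"
      unfolding d1_def d2_def by (simp_all add: algebra_simps)
    then have "o' * d1 = 0" "o' * d2 = 0" unfolding o'(2) by algebra+
    then show ?thesis using o'(1) nz(2) by (simp add: d1_def d2_def vec_eq_iff forall_2)
  qed
  then have "\<exists>!z. ?P z" using Pz by blast
  from theI'[OF this] show
    "metric_sqdist M a (metric_circumcenter M a b c) = metric_sqdist M b (metric_circumcenter M a b c)"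
    "metric_sqdist M b (metric_circumcenter M a b c) = metric_sqdist M c (metric_circumcenter M a b c)"
    unfolding metric_circumcenter_def by blast+
qed

text \<open>The integrand of the roughness for a function with gradient \<open>a\<close>. On a gradient turned by a right
  angle it is the metric square divided by \<open>cv\<close>, which is how the metric enters the comparison.\<close>

definition gradient_energy :: "real \<Rightarrow> real^2 \<Rightarrow> real" where
  "gradient_energy cv a = cv * (a$1)\<^sup>2 + (1 / cv) * (a$2)\<^sup>2"

text \<open>Expansion of the quadratic energy around \<open>g\<close>. In the application \<open>D\<close> is twice a signed triangle
  area and \<open>v\<close> a side turned by a right angle.\<close>

lemma scaled_gradient_energy_update:
  fixes g h v :: "real^2"
  assumes "D \<noteq> 0" "cv \<noteq> 0" and step: "D *\<^sub>R (h - g) = \<delta> *\<^sub>R v"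
  shows "D * gradient_energy cv h =
    D * gradient_energy cv g + 2 * \<delta> * (cv * g$1 * v$1 + g$2 * v$2 / cv) + \<delta>\<^sup>2 * (gradient_energy cv v / D)"
proof -
  define t where "t = \<delta> / D"
  have \<delta>: "\<delta> = D * t" using assms(1) by (simp add: t_def)
  have "h$1 = g$1 + t * v$1" "h$2 = g$2 + t * v$2"
    using arg_cong[OF step, of "\<lambda>w. w$1"] arg_cong[OF step, of "\<lambda>w. w$2"] assms(1)
    by (simp_all add: t_def field_simps)
  then show ?thesis
    using assms(1,2) unfolding \<delta> gradient_energy_def
    by (simp add: field_simps power2_eq_square)
qed

text \<open>The expression equals \<open>orient u1 u2 u4\<close> squared times the power of \<open>u3\<close> with respect to the metric
  circumcircle of \<open>u1, u2, u4\<close>. To see this, measure from \<open>u1\<close> and stretch the second coordinate by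
  \<open>cv\<close>: if \<open>x, y, w\<close> are the resulting positions of \<open>u2, u4, u3\<close> and \<open>m\<close> is the circumcenter, then
  \<open>B w = E x + A y\<close> for the orientations \<open>A, B, E\<close>, and \<open>\<bar>x\<bar>\<^sup>2 = 2 x \<bullet> m\<close>, \<open>\<bar>y\<bar>\<^sup>2 = 2 y \<bullet> m\<close>, while
  the power of \<open>u3\<close> is \<open>\<bar>w\<bar>\<^sup>2 - 2 w \<bullet> m\<close>.\<close>

lemma delaunay_weighted_sum_nonneg:
  assumes del: "anisotropic_delaunay (metric_matrix cv) u1 u2 u3 u4"
    and nz: "orient u1 u2 u4 \<noteq> 0" "cv \<noteq> 0"
  defines "d \<equiv> metric_sqdist (metric_matrix cv)"
  shows "0 \<le> orient u1 u3 u4 * orient u2 u3 u4 * d u1 u2 + orient u1 u2 u3 * orient u2 u3 u4 * d u1 u4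
           - orient u1 u2 u3 * orient u1 u3 u4 * d u2 u4"
proof -
  define z where "z = metric_circumcenter (metric_matrix cv) u1 u2 u4"
  have eq: "d u1 z = d u2 z" "d u2 z = d u4 z"
    unfolding d_def z_def using metric_circumcenter_equidistant[OF nz] by blast+
  have "d u1 z \<ge> 0" by (simp add: d_def metric_sqdist_metric_matrix)
  then have ge: "d u3 z - d u1 z \<ge> 0"
    using del by (simp add: anisotropic_delaunay_def metric_circumradius_def d_def z_def)
  have "orient u1 u3 u4 * orient u2 u3 u4 * d u1 u2 + orient u1 u2 u3 * orient u2 u3 u4 * d u1 u4
           - orient u1 u2 u3 * orient u1 u3 u4 * d u2 u4 = (orient u1 u2 u4)\<^sup>2 * (d u3 z - d u1 z)"
  proof -
    define x2 y2 x3 y3 x4 y4 where "x2 = u2$1 - u1$1" and "y2 = cv * (u2$2 - u1$2)"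
      and "x3 = u3$1 - u1$1" and "y3 = cv * (u3$2 - u1$2)"
      and "x4 = u4$1 - u1$1" and "y4 = cv * (u4$2 - u1$2)"
    define p q where "p = z$1 - u1$1" and "q = cv * (z$2 - u1$2)"
    note coords = x2_def y2_def x3_def y3_def x4_def y4_def p_def q_def
    have o: "cv * orient u1 u2 u4 = x2 * y4 - y2 * x4" "cv * orient u1 u2 u3 = x2 * y3 - y2 * x3"
      "cv * orient u1 u3 u4 = x3 * y4 - y3 * x4"
      "cv * orient u2 u3 u4 = (x2 * y3 - y2 * x3) + (x3 * y4 - y3 * x4) - (x2 * y4 - y2 * x4)"
      by (simp_all add: orient_def coords algebra_simps)
    have dd: "d u1 u2 = x2\<^sup>2 + y2\<^sup>2" "d u1 u4 = x4\<^sup>2 + y4\<^sup>2" "d u2 u4 = (x4 - x2)\<^sup>2 + (y4 - y2)\<^sup>2"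
      "d u3 z - d u1 z = x3\<^sup>2 + y3\<^sup>2 - 2 * (x3 * p + y3 * q)"
      by (simp_all add: d_def metric_sqdist_metric_matrix coords power2_eq_square algebra_simps)
    have z: "x2\<^sup>2 + y2\<^sup>2 = 2 * (x2 * p + y2 * q)" "x4\<^sup>2 + y4\<^sup>2 = 2 * (x4 * p + y4 * q)"
      using eq unfolding d_def metric_sqdist_metric_matrix
      by (simp_all add: coords power2_eq_square algebra_simps)
    define A B E where "A = x2 * y3 - y2 * x3" and "B = x2 * y4 - y2 * x4" and "E = x3 * y4 - y3 * x4"
    have w: "B * x3 = E * x2 + A * x4" "B * y3 = E * y2 + A * y4"
      by (simp_all add: A_def B_def E_def algebra_simps)
    have "E * (A + E - B) * (x2\<^sup>2 + y2\<^sup>2) + A * (A + E - B) * (x4\<^sup>2 + y4\<^sup>2)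
        - A * E * ((x4 - x2)\<^sup>2 + (y4 - y2)\<^sup>2)
      = (E * x2 + A * x4)\<^sup>2 + (E * y2 + A * y4)\<^sup>2 - B * (E * (x2\<^sup>2 + y2\<^sup>2) + A * (x4\<^sup>2 + y4\<^sup>2))"
      by (simp add: power2_eq_square algebra_simps)
    also have "\<dots> = (B * x3)\<^sup>2 + (B * y3)\<^sup>2 - B * (2 * ((E * x2 + A * x4) * p + (E * y2 + A * y4) * q))"
      unfolding w z by (simp add: algebra_simps)
    also have "\<dots> = B\<^sup>2 * (x3\<^sup>2 + y3\<^sup>2 - 2 * (x3 * p + y3 * q))"
      unfolding w[symmetric] by (simp add: power2_eq_square algebra_simps)
    finally have "(cv * orient u1 u3 u4) * (cv * orient u2 u3 u4) * d u1 u2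
        + (cv * orient u1 u2 u3) * (cv * orient u2 u3 u4) * d u1 u4
        - (cv * orient u1 u2 u3) * (cv * orient u1 u3 u4) * d u2 u4
      = (cv * orient u1 u2 u4)\<^sup>2 * (d u3 z - d u1 z)"
      unfolding o dd A_def B_def E_def by simp
    then have "cv\<^sup>2 * (orient u1 u3 u4 * orient u2 u3 u4 * d u1 u2 + orient u1 u2 u3 * orient u2 u3 u4 * d u1 u4
           - orient u1 u2 u3 * orient u1 u3 u4 * d u2 u4) = cv\<^sup>2 * ((orient u1 u2 u4)\<^sup>2 * (d u3 z - d u1 z))"
      by (simp add: power2_eq_square algebra_simps)
    then show ?thesis using nz(2) by simp
  qed
  then show ?thesis using ge by simp
qed

text \<open>Let \<open>\<delta>\<close> be the amount by which \<open>f3\<close> misses the affine extension of the data on \<open>u1, u2, u4\<close>. Each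
  of the other three gradients differs from \<open>g1\<close> by \<open>\<delta>\<close> times a turned side divided by twice the
  signed area. In the difference of the energies the constant terms cancel because both pairs of
  triangles have the same total area, and the terms linear in \<open>\<delta>\<close> cancel because the turned sides of
  \<open>u1, u2, u4\<close> add up to zero. The factor of \<open>\<delta>\<^sup>2\<close> that remains is the nonnegative sum of the
  previous lemma divided by \<open>cv A E C\<close>.\<close>

lemma edge_flip_energy:
  fixes g1 g2 h1 h2 :: "real^2" and \<sigma> cv :: real
  assumes \<sigma>: "\<sigma> * orient u1 u2 u4 > 0" "\<sigma> * orient u2 u3 u4 > 0"
      "\<sigma> * orient u1 u2 u3 > 0" "\<sigma> * orient u1 u3 u4 > 0"
    and cv: "cv > 0"
    and g1: "g1 \<bullet> (u2 - u1) = f2 - f1" "g1 \<bullet> (u4 - u1) = f4 - f1"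
    and g2: "g2 \<bullet> (u3 - u2) = f3 - f2" "g2 \<bullet> (u4 - u2) = f4 - f2"
    and h1: "h1 \<bullet> (u2 - u1) = f2 - f1" "h1 \<bullet> (u3 - u1) = f3 - f1"
    and h2: "h2 \<bullet> (u3 - u1) = f3 - f1" "h2 \<bullet> (u4 - u1) = f4 - f1"
    and del: "anisotropic_delaunay (metric_matrix cv) u1 u2 u3 u4"
  shows "\<sigma> * (orient u1 u2 u4 * gradient_energy cv g1 + orient u2 u3 u4 * gradient_energy cv g2)
       \<le> \<sigma> * (orient u1 u2 u3 * gradient_energy cv h1 + orient u1 u3 u4 * gradient_energy cv h2)"
proof -
  define A B C E where "A = orient u1 u2 u3" and "B = orient u1 u2 u4"
    and "C = orient u2 u3 u4" and "E = orient u1 u3 u4"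
  note ABCE = A_def B_def C_def E_def
  have nz: "A \<noteq> 0" "B \<noteq> 0" "C \<noteq> 0" "E \<noteq> 0" using \<sigma> by (auto simp: ABCE)
  have sum: "A + E = B + C" by (simp add: ABCE orient_def algebra_simps)
  define \<delta> where "\<delta> = f3 - f1 - g1 \<bullet> (u3 - u1)"
  let ?n = side_normal
  have s1: "A *\<^sub>R (h1 - g1) = \<delta> *\<^sub>R ?n u1 u2"
    using g1 h1 unfolding \<delta>_def ABCE orient_def vec_eq_iff forall_2 side_normal_def inner_2 vector_2
      vector_scaleR_component vector_minus_component real_scaleR_def by algebra
  have s2: "E *\<^sub>R (h2 - g1) = \<delta> *\<^sub>R ?n u4 u1"
    using g1 h2 unfolding \<delta>_def ABCE orient_def vec_eq_iff forall_2 side_normal_def inner_2 vector_2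
      vector_scaleR_component vector_minus_component real_scaleR_def by algebra
  have s3: "C *\<^sub>R (g2 - g1) = \<delta> *\<^sub>R ?n u4 u2"
    using g1 g2 unfolding \<delta>_def ABCE orient_def vec_eq_iff forall_2 side_normal_def inner_2 vector_2
      vector_scaleR_component vector_minus_component real_scaleR_def by algebra
  have e: "gradient_energy cv (?n a b) = metric_sqdist (metric_matrix cv) b a / cv" for a b
    using cv by (simp add: gradient_energy_def side_normal_def vector_2 metric_sqdist_metric_matrix field_simps power2_eq_square)
  have comm: "metric_sqdist (metric_matrix cv) a b = metric_sqdist (metric_matrix cv) b a" for a b
    by (simp add: metric_sqdist_metric_matrix power2_commute)
  let ?d = "metric_sqdist (metric_matrix cv)"
  define S where "S = E * C * ?d u1 u2 + A * C * ?d u1 u4 - A * E * ?d u2 u4"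
  have S: "S \<ge> 0"
    unfolding S_def ABCE using delaunay_weighted_sum_nonneg[OF del] nz cv by (simp add: ABCE)
  have normals: "?n u1 u2 + ?n u4 u1 = ?n u4 u2"
    by (simp add: side_normal_def vec_eq_iff forall_2 vector_2)
  have n1: "?n u4 u2 $ 1 = ?n u1 u2 $ 1 + ?n u4 u1 $ 1" and n2: "?n u4 u2 $ 2 = ?n u1 u2 $ 2 + ?n u4 u1 $ 2"
    unfolding normals[symmetric] by simp_all
  have "A * gradient_energy cv h1 + E * gradient_energy cv h2 - (B * gradient_energy cv g1 + C * gradient_energy cv g2)
      = (A + E - B - C) * gradient_energy cv g1
        + \<delta>\<^sup>2 * (gradient_energy cv (?n u1 u2) / A + gradient_energy cv (?n u4 u1) / E - gradient_energy cv (?n u4 u2) / C)"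
    unfolding scaled_gradient_energy_update[OF nz(1) _ s1, of cv, OF less_imp_neq[OF cv, symmetric]]
      scaled_gradient_energy_update[OF nz(4) _ s2, of cv, OF less_imp_neq[OF cv, symmetric]]
      scaled_gradient_energy_update[OF nz(3) _ s3, of cv, OF less_imp_neq[OF cv, symmetric]]
      n1 n2
    by (simp add: algebra_simps add_divide_distrib)
  also have "\<dots> = \<delta>\<^sup>2 * (S / (cv * (A * E * C)))"
    unfolding e sum S_def using nz cv sum comm[of u1 u2] comm[of u2 u4] by (simp add: field_simps)
  finally have eq: "A * gradient_energy cv h1 + E * gradient_energy cv h2
      - (B * gradient_energy cv g1 + C * gradient_energy cv g2) = \<delta>\<^sup>2 * (S / (cv * (A * E * C)))" .
  have "\<sigma> * (S / (cv * (A * E * C))) \<ge> 0"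
  proof -
    have "\<sigma> * (A * E * C) * \<sigma>\<^sup>2 = (\<sigma> * A) * (\<sigma> * E) * (\<sigma> * C)" by (simp add: power2_eq_square)
    also have "\<dots> > 0" using \<sigma> by (simp add: ABCE)
    finally have "\<sigma> * (A * E * C) > 0" by (simp add: zero_less_mult_iff)
    then have "\<sigma> / (A * E * C) > 0" by (auto simp: zero_less_mult_iff zero_less_divide_iff)
    then have "\<sigma> / (A * E * C) * (S / cv) \<ge> 0" using S cv by (intro mult_nonneg_nonneg) auto
    then show ?thesis by (simp add: mult.commute)
  qed
  then have "\<delta>\<^sup>2 * (\<sigma> * (S / (cv * (A * E * C)))) \<ge> 0" by (rule mult_nonneg_nonneg[OF zero_le_power2])
  moreover have "\<delta>\<^sup>2 * (\<sigma> * (S / (cv * (A * E * C)))) = \<sigma> * (A * gradient_energy cv h1 + E * gradient_energy cv h2)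
     - \<sigma> * (B * gradient_energy cv g1 + C * gradient_energy cv g2)"
    unfolding right_diff_distrib[symmetric] eq by simp
  ultimately show ?thesis by (simp add: ABCE)
qed

section \<open>Roughness of a piecewise affine function on two triangles\<close>

lemma has_weak_partial_cong:
  assumes "has_weak_partial \<Omega> i g h" and eq: "\<And>p. p \<in> \<Omega> \<Longrightarrow> g' p = g p"
  shows "has_weak_partial \<Omega> i g' h"
proof -
  have "locally_integrable_on g' \<Omega> \<longleftrightarrow> locally_integrable_on g \<Omega>"
    unfolding locally_integrable_on_def using eq by (auto simp: subset_iff cong: set_integrable_cong)
  moreover have "(LINT p:\<Omega>|lebesgue. g' p * f p) = (LINT p:\<Omega>|lebesgue. g p * f p)" for f
    unfolding set_lebesgue_integral_def
    by (rule Bochner_Integration.integral_cong) (auto simp: indicator_def eq)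
  ultimately show ?thesis using assms(1) by (simp add: has_weak_partial_def)
qed

lemma affine_agree_on_line:
  assumes "w \<bullet> p + c = 0" "w \<bullet> q + c = 0"
  shows "(w \<bullet> x + c) * orient p q s = (w \<bullet> s + c) * orient p q x"
proof -
  have c: "c = - (w \<bullet> p)" using assms(1) by simp
  have "w \<bullet> (q - p) = 0" using assms by (simp add: inner_diff_right)
  then have 0: "w$1 * (q$1 - p$1) + w$2 * (q$2 - p$2) = 0" by (simp add: inner_2)
  show ?thesis
    unfolding c inner_2 orient_def using 0 by algebra
qed

text \<open>A continuous function that is affine on either side of a line, written as an affine function plus
  a multiple of the positive part of the height above the line. The formula makes it Lipschitz on the
  whole plane, and it is differentiable off the line, which is a null set.\<close>

lemma roof_function_has_weak_partial:
  fixes n a :: "real^2" and m :: real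
  assumes n: "n \<noteq> 0"
  defines "height \<equiv> \<lambda>x. n \<bullet> x - m"
  shows "has_weak_partial \<Omega> i (\<lambda>x. a \<bullet> x + b + \<kappa> * max 0 (height x))
          (\<lambda>x. a $ i + \<kappa> * n $ i * indicator {x. height x > 0} x)"
proof (rule Lipschitz_has_weak_partial)
  show "(norm a + \<bar>\<kappa>\<bar> * norm n)-lipschitz_on UNIV (\<lambda>x. a \<bullet> x + b + \<kappa> * max 0 (height x))"
  proof (rule lipschitz_onI)
    fix x y :: "real^2"
    have "\<bar>max 0 (height x) - max 0 (height y)\<bar> \<le> \<bar>n \<bullet> (x - y)\<bar>"
      by (auto simp: height_def inner_diff_right)
    also have "\<dots> \<le> norm n * norm (x - y)" by (rule Cauchy_Schwarz_ineq2)
    finally have "\<bar>\<kappa>\<bar> * \<bar>max 0 (height x) - max 0 (height y)\<bar> \<le> \<bar>\<kappa>\<bar> * (norm n * norm (x - y))"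
      by (rule mult_left_mono) simp
    moreover have "\<bar>a \<bullet> (x - y)\<bar> \<le> norm a * norm (x - y)" by (rule Cauchy_Schwarz_ineq2)
    moreover have "(a \<bullet> x + b + \<kappa> * max 0 (height x)) - (a \<bullet> y + b + \<kappa> * max 0 (height y))
        = a \<bullet> (x - y) + \<kappa> * (max 0 (height x) - max 0 (height y))"
      by (simp add: inner_diff_right algebra_simps)
    ultimately have "\<bar>(a \<bullet> x + b + \<kappa> * max 0 (height x)) - (a \<bullet> y + b + \<kappa> * max 0 (height y))\<bar>
        \<le> norm a * norm (x - y) + \<bar>\<kappa>\<bar> * (norm n * norm (x - y))"
      using abs_triangle_ineq[of "a \<bullet> (x - y)" "\<kappa> * (max 0 (height x) - max 0 (height y))"]
      unfolding abs_mult by linarith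
    then show "dist (a \<bullet> x + b + \<kappa> * max 0 (height x)) (a \<bullet> y + b + \<kappa> * max 0 (height y))
        \<le> (norm a + \<bar>\<kappa>\<bar> * norm n) * dist x y"
      by (simp add: dist_norm distrib_right mult.assoc)
  qed simp
next
  have const: "locally_integrable_on (\<lambda>_. c) \<Omega>" for c
    by (rule continuous_locally_integrable) simp
  show "locally_integrable_on (\<lambda>x. a $ i + \<kappa> * n $ i * indicator {x. height x > 0} x) \<Omega>"
    unfolding locally_integrable_on_def
  proof (intro allI impI, elim conjE)
    fix K assume K: "compact K" "K \<subseteq> \<Omega>"
    have pos: "{x. height x > 0} \<in> sets lebesgue"
      unfolding height_def by (simp add: open_halfspace_gt borel_open)
    have c: "integrable lebesgue (\<lambda>x. indicator K x *\<^sub>R c)" for c :: real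
      using const[of c] K by (simp add: locally_integrable_on_def set_integrable_def)
    have "integrable lebesgue (\<lambda>x. indicator K x *\<^sub>R (a $ i)
        + indicator {x. height x > 0} x *\<^sub>R (indicator K x *\<^sub>R (\<kappa> * n $ i)))"
      by (intro Bochner_Integration.integrable_add c integrable_mult_indicator[OF pos])
    then show "(\<lambda>x. a $ i + \<kappa> * n $ i * indicator {x. height x > 0} x) absolutely_integrable_on K"
      by (simp add: set_integrable_def algebra_simps)
  qed
next
  have "AE p in lebesgue. p \<notin> {x. n \<bullet> x = m}"
    using negligible_hyperplane[of n m] n by (intro AE_not_in) (simp add: negligible_iff_null_sets)
  then show "AE p in lebesgue. p \<in> \<Omega> \<longrightarrow>
      ((\<lambda>s. a \<bullet> (p + s *\<^sub>R axis i 1) + b + \<kappa> * max 0 (height (p + s *\<^sub>R axis i 1)))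
        has_real_derivative a $ i + \<kappa> * n $ i * indicator {x. height x > 0} p) (at 0)"
  proof eventually_elim
    case (elim p)
    have height_s: "height (p + s *\<^sub>R axis i 1) = height p + s * n $ i" for s
      by (simp add: height_def inner_add_right inner_axis)
    have inner_s: "a \<bullet> (p + s *\<^sub>R axis i 1) = a \<bullet> p + s * a $ i" for s
      by (simp add: inner_add_right inner_axis)
    have lim: "((\<lambda>s. height p + s * n $ i) \<longlongrightarrow> height p + 0 * n $ i) (nhds 0)"
      by (intro tendsto_intros) (rule filterlim_ident)
    have "((\<lambda>s. a \<bullet> (p + s *\<^sub>R axis i 1) + b + \<kappa> * max 0 (height (p + s *\<^sub>R axis i 1)))
        has_real_derivative a $ i + \<kappa> * n $ i * indicator {x. height x > 0} p) (at 0)"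
      unfolding height_s inner_s
    proof (cases "height p > 0")
      case True
      have ev: "\<forall>\<^sub>F s in nhds 0. height p + s * n $ i > 0"
        using order_tendstoD(1)[OF lim] True by simp
      have D: "((\<lambda>s. a \<bullet> p + s * a $ i + b + \<kappa> * (height p + s * n $ i)) has_real_derivative a $ i + \<kappa> * n $ i) (at 0)"
        by (auto intro!: derivative_eq_intros)
      have E: "\<forall>\<^sub>F s in nhds 0. a \<bullet> p + s * a $ i + b + \<kappa> * (height p + s * n $ i)
          = a \<bullet> p + s * a $ i + b + \<kappa> * max 0 (height p + s * n $ i)"
        using ev by eventually_elim simp
      show "((\<lambda>s. a \<bullet> p + s * a $ i + b + \<kappa> * max 0 (height p + s * n $ i))
          has_real_derivative a $ i + \<kappa> * n $ i * indicator {x. height x > 0} p) (at 0)"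
        using DERIV_cong_ev[OF refl E refl, THEN iffD1, OF D] True by simp
    next
      case False
      then have "height p < 0" using elim by (simp add: height_def)
      then have ev: "\<forall>\<^sub>F s in nhds 0. height p + s * n $ i < 0"
        using order_tendstoD(2)[OF lim] by simp
      have D: "((\<lambda>s. a \<bullet> p + s * a $ i + b) has_real_derivative a $ i) (at 0)"
        by (auto intro!: derivative_eq_intros)
      have E: "\<forall>\<^sub>F s in nhds 0. a \<bullet> p + s * a $ i + b
          = a \<bullet> p + s * a $ i + b + \<kappa> * max 0 (height p + s * n $ i)"
        using ev by eventually_elim simp
      show "((\<lambda>s. a \<bullet> p + s * a $ i + b + \<kappa> * max 0 (height p + s * n $ i))
          has_real_derivative a $ i + \<kappa> * n $ i * indicator {x. height x > 0} p) (at 0)"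
        using DERIV_cong_ev[OF refl E refl, THEN iffD1, OF D] False by simp
    qed
    then show ?case by simp
  qed
qed

lemma set_integral_triangle_AE_const:
  fixes c :: real
  assumes "AE x in lebesgue. x \<in> convex hull {p, q, r} \<longrightarrow> f x = c"
  shows "(LINT x:convex hull {p, q, r}|lebesgue. f x) = \<bar>orient p q r\<bar> / 2 * c"
proof -
  let ?S = "convex hull {p, q, r}"
  have S: "compact ?S" by (intro finite_imp_compact_convex_hull) auto
  then have borel: "?S \<in> sets lborel" by (auto intro: borel_closed compact_imp_closed)
  then have meas: "?S \<in> sets lebesgue" by auto
  have cm: "(\<lambda>x. indicator ?S x * c) \<in> borel_measurable lebesgue" using meas by measurable
  have eq: "AE x in lebesgue. indicator ?S x * c = indicator ?S x * f x"
    using assms by eventually_elim (simp add: indicator_def)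
  have "(LINT x:?S|lebesgue. f x) = (\<integral>x. indicator ?S x * f x \<partial>lebesgue)"
    by (simp add: set_lebesgue_integral_def)
  also have "\<dots> = (\<integral>x. indicator ?S x * c \<partial>lebesgue)"
  proof (rule integral_cong_AE[OF borel_measurable_AE[OF cm eq] cm])
    show "AE x in lebesgue. indicator ?S x * f x = indicator ?S x * c"
      using eq by eventually_elim (rule sym)
  qed
  also have "\<dots> = measure lebesgue ?S * c" by simp
  also have "measure lebesgue ?S = measure lborel ?S" using borel by (rule measure_completion)
  also have "\<dots> = \<bar>orient p q r\<bar> / 2"
    unfolding content_triangle orient_def by (simp add: abs_minus_commute mult.commute)
  finally show ?thesis .
qed

text \<open>The triangles lie on opposite sides of the line through their common side \<open>p q\<close>. The two affine
  pieces agree at \<open>p\<close> and \<open>q\<close>, so their difference is a multiple of \<open>orient p q\<close>, and \<open>g\<close> is the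
  restriction of a roof function to the union. The chosen weak gradient is therefore the constant
  \<open>a1\<close> or \<open>a2\<close> almost everywhere on a triangle, since triangles have null boundaries.\<close>

lemma roughness_sq_two_triangles:
  assumes R1: "triangle_region \<tau>1 = convex hull {p, q, r}"
    and R2: "triangle_region \<tau>2 = convex hull {p, q, s}"
    and opp: "orient p q r < 0" "orient p q s > 0"
    and g1: "\<And>x. x \<in> triangle_region \<tau>1 \<Longrightarrow> g x = a1 \<bullet> x + b1"
    and g2: "\<And>x. x \<in> triangle_region \<tau>2 \<Longrightarrow> g x = a2 \<bullet> x + b2"
  shows "roughness_sq cv {\<tau>1, \<tau>2} g =
     \<bar>orient p q r\<bar> / 2 * gradient_energy cv a1 + \<bar>orient p q s\<bar> / 2 * gradient_energy cv a2"
proof -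
  define n where "n = side_normal p q"
  define m where "m = n \<bullet> p"
  have height: "n \<bullet> x - m = orient p q x" for x by (simp add: orient_eq_inner n_def m_def)
  have n0: "n \<noteq> 0" using opp height[of s] height[of p] by (auto simp: m_def)
  define \<kappa> where "\<kappa> = ((a2 - a1) \<bullet> s + (b2 - b1)) / orient p q s"
  have jump: "(a2 - a1) \<bullet> x + (b2 - b1) = \<kappa> * orient p q x" for x
  proof -
    have "p \<in> triangle_region \<tau>1" "q \<in> triangle_region \<tau>1" "p \<in> triangle_region \<tau>2" "q \<in> triangle_region \<tau>2"
      unfolding R1 R2 by (simp_all add: hull_inc)
    then have "a1 \<bullet> p + b1 = a2 \<bullet> p + b2" "a1 \<bullet> q + b1 = a2 \<bullet> q + b2" using g1 g2 by metis+
    then have "((a2 - a1) \<bullet> x + (b2 - b1)) * orient p q s = ((a2 - a1) \<bullet> s + (b2 - b1)) * orient p q x"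
      by (intro affine_agree_on_line) (simp_all add: inner_diff_left)
    then show ?thesis using opp by (simp add: \<kappa>_def field_simps)
  qed
  have gradient: "a2 = a1 + \<kappa> *\<^sub>R n"
  proof -
    \<comment> \<open>The jump identity holds for all \<open>x\<close>, so comparing it with its value at the origin leaves a
      linear functional that vanishes identically.\<close>
    have "(a2 - a1 - \<kappa> *\<^sub>R n) \<bullet> x = (a2 - a1 - \<kappa> *\<^sub>R n) \<bullet> 0" for x
      using jump[of x] jump[of 0] unfolding height[symmetric]
      by (simp add: inner_diff_left algebra_simps)
    then have "a2 - a1 - \<kappa> *\<^sub>R n = 0" by (metis inner_eq_zero_iff inner_zero_right)
    then show ?thesis by (simp add: algebra_simps)
  qed
  have side1: "orient p q x \<le> 0" if "x \<in> triangle_region \<tau>1" for x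
  proof -
    have "convex hull {p, q, r} \<subseteq> {x. n \<bullet> x \<le> m}"
      using opp height[of r] height[of q]
      by (intro hull_minimal convex_halfspace_le) (auto simp: m_def orient_def)
    then show ?thesis using that height[of x] by (auto simp: R1)
  qed
  have side2: "orient p q x \<ge> 0" if "x \<in> triangle_region \<tau>2" for x
  proof -
    have "convex hull {p, q, s} \<subseteq> {x. n \<bullet> x \<ge> m}"
      using opp height[of s] height[of q]
      by (intro hull_minimal convex_halfspace_ge) (auto simp: m_def orient_def)
    then show ?thesis using that height[of x] by (auto simp: R2)
  qed
  define \<Omega> where "\<Omega> = interior (triangulated_region {\<tau>1, \<tau>2})"
  define h where "h i x = a1 $ i + \<kappa> * n $ i * indicator {x. n \<bullet> x - m > 0} x" for i x
  have "g x = a1 \<bullet> x + b1 + \<kappa> * max 0 (n \<bullet> x - m)" if "x \<in> \<Omega>" for x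
  proof -
    have "x \<in> triangle_region \<tau>1 \<or> x \<in> triangle_region \<tau>2"
      using that interior_subset by (auto simp: \<Omega>_def triangulated_region_def)
    then show ?thesis
    proof
      assume "x \<in> triangle_region \<tau>1"
      then show ?thesis using side1[of x] g1[of x] by (simp add: height)
    next
      assume "x \<in> triangle_region \<tau>2"
      then show ?thesis using side2[of x] g2[of x] jump[of x]
        by (simp add: height inner_diff_left)
    qed
  qed
  then have "has_weak_partial \<Omega> i g (h i)" for i
    unfolding h_def by (rule has_weak_partial_cong[OF roof_function_has_weak_partial[OF n0]])
  then have "has_weak_partial \<Omega> i g (weak_partial \<Omega> i g)" "has_weak_partial \<Omega> i g (h i)" for i
    unfolding weak_partial_def using someI[of "has_weak_partial \<Omega> i g" "h i"] by blast+
  then have weak_i: "AE x in lebesgue. x \<in> \<Omega> \<longrightarrow> weak_partial \<Omega> i g x = h i x" for i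
    unfolding \<Omega>_def by (rule has_weak_partial_AE_unique[OF open_interior])
  have weak: "AE x in lebesgue. x \<in> \<Omega> \<longrightarrow> weak_partial \<Omega> 1 g x = h 1 x \<and> weak_partial \<Omega> 2 g x = h 2 x"
    using weak_i[of 1] weak_i[of 2] by eventually_elim simp
  have line: "AE x in lebesgue. n \<bullet> x \<noteq> m"
    using AE_not_in[of "{x. n \<bullet> x = m}" lebesgue] negligible_hyperplane[of n m] n0
    by (simp add: negligible_iff_null_sets)
  have inside: "AE x in lebesgue. x \<in> triangle_region \<tau> \<longrightarrow> x \<in> \<Omega>" if "\<tau> \<in> {\<tau>1, \<tau>2}" for \<tau>
  proof -
    have cv: "convex (triangle_region \<tau>)" "closed (triangle_region \<tau>)"
      using that R1 R2 by (auto intro!: compact_imp_closed finite_imp_compact_convex_hull)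
    have "frontier (triangle_region \<tau>) \<in> null_sets lebesgue"
      using negligible_convex_frontier[OF cv(1)] by (simp add: negligible_iff_null_sets)
    then have "AE x in lebesgue. x \<notin> frontier (triangle_region \<tau>)" by (rule AE_not_in)
    moreover have "interior (triangle_region \<tau>) \<subseteq> \<Omega>"
      unfolding \<Omega>_def triangulated_region_def using that by (intro interior_mono) auto
    ultimately show ?thesis
      by (auto simp: frontier_def closure_closed[OF cv(2)] elim!: eventually_mono)
  qed
  let ?I = "\<lambda>x. cv * (weak_partial \<Omega> 1 g x)\<^sup>2 + (1 / cv) * (weak_partial \<Omega> 2 g x)\<^sup>2"
  have "AE x in lebesgue. x \<in> triangle_region \<tau>1 \<longrightarrow> ?I x = gradient_energy cv a1"
    using weak inside[of \<tau>1, simplified]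
  proof eventually_elim
    case (elim x)
    show ?case
    proof
      assume x: "x \<in> triangle_region \<tau>1"
      then have "h i x = a1 $ i" for i using side1[OF x] by (simp add: h_def height)
      then show "?I x = gradient_energy cv a1" using elim x by (simp add: gradient_energy_def)
    qed
  qed
  then have I1: "(LINT x:triangle_region \<tau>1|lebesgue. ?I x) = \<bar>orient p q r\<bar> / 2 * gradient_energy cv a1"
    unfolding R1 by (rule set_integral_triangle_AE_const)
  have "AE x in lebesgue. x \<in> triangle_region \<tau>2 \<longrightarrow> ?I x = gradient_energy cv a2"
    using weak line inside[of \<tau>2, simplified]
  proof eventually_elim
    case (elim x)
    show ?case
    proof
      assume x: "x \<in> triangle_region \<tau>2"
      then have "orient p q x > 0" using side2[OF x] elim(2) height[of x] by simp
      then have "h i x = a2 $ i" for i by (simp add: h_def height gradient)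
      then show "?I x = gradient_energy cv a2" using elim x by (simp add: gradient_energy_def)
    qed
  qed
  then have I2: "(LINT x:triangle_region \<tau>2|lebesgue. ?I x) = \<bar>orient p q s\<bar> / 2 * gradient_energy cv a2"
    unfolding R2 by (rule set_integral_triangle_AE_const)
  have "\<tau>1 \<noteq> \<tau>2"
  proof
    assume "\<tau>1 = \<tau>2"
    then have "s \<in> triangle_region \<tau>1" by (simp add: R2 hull_inc)
    then show False using side1[of s] opp by simp
  qed
  then show ?thesis
    unfolding roughness_sq_def Let_def \<Omega>_def[symmetric] using I1 I2 by simp
qed

text \<open>The same for any continuous piecewise affine function and for either orientation \<open>\<sigma>\<close>. The
  gradients are described by the increments of \<open>g\<close>, the form in which interpolation data determine
  them.\<close>

lemma roughness_sq_piecewise_affine: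
  assumes R1: "triangle_region \<tau>1 = convex hull {p, q, r}"
    and R2: "triangle_region \<tau>2 = convex hull {p, q, s}"
    and opp: "\<sigma> * orient p q r < 0" "\<sigma> * orient p q s > 0"
    and g: "piecewise_affine_on {\<tau>1, \<tau>2} g"
  obtains a1 a2 where
    "\<And>x y. x \<in> triangle_region \<tau>1 \<Longrightarrow> y \<in> triangle_region \<tau>1 \<Longrightarrow> a1 \<bullet> (y - x) = g y - g x"
    "\<And>x y. x \<in> triangle_region \<tau>2 \<Longrightarrow> y \<in> triangle_region \<tau>2 \<Longrightarrow> a2 \<bullet> (y - x) = g y - g x"
    "roughness_sq cv {\<tau>1, \<tau>2} g =
     \<bar>orient p q r\<bar> / 2 * gradient_energy cv a1 + \<bar>orient p q s\<bar> / 2 * gradient_energy cv a2"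
proof -
  obtain a1 b1 where g1: "\<And>x. x \<in> triangle_region \<tau>1 \<Longrightarrow> g x = a1 \<bullet> x + b1"
    using g unfolding piecewise_affine_on_def by blast
  obtain a2 b2 where g2: "\<And>x. x \<in> triangle_region \<tau>2 \<Longrightarrow> g x = a2 \<bullet> x + b2"
    using g unfolding piecewise_affine_on_def by blast
  have "roughness_sq cv {\<tau>1, \<tau>2} g =
     \<bar>orient p q r\<bar> / 2 * gradient_energy cv a1 + \<bar>orient p q s\<bar> / 2 * gradient_energy cv a2"
  proof (cases "\<sigma> > 0")
    case True
    then show ?thesis
      using opp g1 g2 by (intro roughness_sq_two_triangles[OF R1 R2]) (auto simp: mult_less_0_iff zero_less_mult_iff)
  next
    case False
    then have "orient p q s < 0" "orient p q r > 0"
      using opp by (auto simp: mult_less_0_iff zero_less_mult_iff)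
    then have "roughness_sq cv {\<tau>2, \<tau>1} g =
       \<bar>orient p q s\<bar> / 2 * gradient_energy cv a2 + \<bar>orient p q r\<bar> / 2 * gradient_energy cv a1"
      using g1 g2 by (intro roughness_sq_two_triangles[OF R2 R1])
    then show ?thesis by (simp add: insert_commute)
  qed
  then show thesis
    using g1 g2 by (intro that[of a1 a2]) (simp_all add: inner_diff_right)
qed

section \<open>Delaunay triangulations minimise the roughness\<close>

theorem theorem1:
  fixes u1 u2 u3 u4 v :: "real^2"
    and f1 f2 f3 f4 cv :: real
    and c :: "real \<Rightarrow> real"
    and G H :: "real^2 \<Rightarrow> real"
    and T Tstar :: "triangle set"
  assumes c_smooth: "smooth_real c"
    and c_pos: "\<And>x. c x > 0"
    and quad: "strictly_convex_quadrilateral u1 u2 u3 u4"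
    and v_midpoint: "v = midpoint u2 u4 \<or> v = midpoint u1 u3"
    and cv_eq: "cv = c (v $ 1)"
    and T_eq: "T = {(u1, u2, u4), (u2, u3, u4)}"
    and Tstar_eq: "Tstar = {(u1, u2, u3), (u1, u3, u4)}"
    and G_affine: "piecewise_affine_on T G"
    and G_interp: "G u1 = f1" "G u2 = f2" "G u3 = f3" "G u4 = f4"
    and H_affine: "piecewise_affine_on Tstar H"
    and H_interp: "H u1 = f1" "H u2 = f2" "H u3 = f3" "H u4 = f4"
    and delaunay: "anisotropic_delaunay (metric_matrix cv) u1 u2 u3 u4"
  shows "roughness_sq cv Tstar H - roughness_sq cv T G \<ge> 0"
proof -
  have cv: "cv > 0" using c_pos cv_eq by simp
  obtain \<sigma> :: real where \<sigma>1: "\<bar>\<sigma>\<bar> = 1" and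
    \<sigma>: "\<sigma> * orient u1 u2 u4 > 0" "\<sigma> * orient u2 u3 u4 > 0" "\<sigma> * orient u1 u2 u3 > 0" "\<sigma> * orient u1 u3 u4 > 0"
    using strictly_convex_quadrilateral_orient[OF quad] by metis
  have area: "\<bar>x\<bar> = \<sigma> * x" if "\<sigma> * x > 0" for x
  proof -
    have "\<bar>\<sigma> * x\<bar> = \<bar>x\<bar>" using \<sigma>1 by (simp add: abs_mult)
    then show ?thesis using that by simp
  qed
  \<comment> \<open>The common sides are the diagonals; reading each triangle from its diagonal permutes the
    vertices, and an odd permutation changes the sign.\<close>
  have flip: "orient u2 u4 u1 = orient u1 u2 u4" "orient u2 u4 u3 = - orient u2 u3 u4"
      "orient u1 u3 u2 = - orient u1 u2 u3"
    by (simp_all add: orient_def algebra_simps)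
  have verts: "u1 \<in> triangle_region (u1, u2, u4)" "u2 \<in> triangle_region (u1, u2, u4)" "u4 \<in> triangle_region (u1, u2, u4)"
    "u2 \<in> triangle_region (u2, u3, u4)" "u3 \<in> triangle_region (u2, u3, u4)" "u4 \<in> triangle_region (u2, u3, u4)"
    "u1 \<in> triangle_region (u1, u2, u3)" "u2 \<in> triangle_region (u1, u2, u3)" "u3 \<in> triangle_region (u1, u2, u3)"
    "u1 \<in> triangle_region (u1, u3, u4)" "u3 \<in> triangle_region (u1, u3, u4)" "u4 \<in> triangle_region (u1, u3, u4)"
    by (simp_all add: hull_inc)
  obtain g2 g1 where
    g2: "\<And>x y. x \<in> triangle_region (u2, u3, u4) \<Longrightarrow> y \<in> triangle_region (u2, u3, u4) \<Longrightarrow> g2 \<bullet> (y - x) = G y - G x" and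
    g1: "\<And>x y. x \<in> triangle_region (u1, u2, u4) \<Longrightarrow> y \<in> triangle_region (u1, u2, u4) \<Longrightarrow> g1 \<bullet> (y - x) = G y - G x" and
    RG: "roughness_sq cv {(u2, u3, u4), (u1, u2, u4)} G =
      \<bar>orient u2 u4 u3\<bar> / 2 * gradient_energy cv g2 + \<bar>orient u2 u4 u1\<bar> / 2 * gradient_energy cv g1"
  proof (rule roughness_sq_piecewise_affine[of "(u2, u3, u4)" u2 u4 u3 "(u1, u2, u4)" u1 \<sigma> G cv])
    show "piecewise_affine_on {(u2, u3, u4), (u1, u2, u4)} G" using G_affine T_eq by (simp add: insert_commute)
  qed (use \<sigma> in \<open>auto simp: insert_commute flip\<close>)
  obtain h1 h2 where
    h1: "\<And>x y. x \<in> triangle_region (u1, u2, u3) \<Longrightarrow> y \<in> triangle_region (u1, u2, u3) \<Longrightarrow> h1 \<bullet> (y - x) = H y - H x" and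
    h2: "\<And>x y. x \<in> triangle_region (u1, u3, u4) \<Longrightarrow> y \<in> triangle_region (u1, u3, u4) \<Longrightarrow> h2 \<bullet> (y - x) = H y - H x" and
    RH: "roughness_sq cv {(u1, u2, u3), (u1, u3, u4)} H =
      \<bar>orient u1 u3 u2\<bar> / 2 * gradient_energy cv h1 + \<bar>orient u1 u3 u4\<bar> / 2 * gradient_energy cv h2"
  proof (rule roughness_sq_piecewise_affine[of "(u1, u2, u3)" u1 u3 u2 "(u1, u3, u4)" u4 \<sigma> H cv])
    show "piecewise_affine_on {(u1, u2, u3), (u1, u3, u4)} H" using H_affine Tstar_eq by simp
  qed (use \<sigma> in \<open>auto simp: insert_commute flip\<close>)
  have "\<sigma> * (orient u1 u2 u4 * gradient_energy cv g1 + orient u2 u3 u4 * gradient_energy cv g2)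
       \<le> \<sigma> * (orient u1 u2 u3 * gradient_energy cv h1 + orient u1 u3 u4 * gradient_energy cv h2)"
    by (rule edge_flip_energy[OF \<sigma> cv _ _ _ _ _ _ _ _ delaunay, of _ f2 f1 f4 _ f3])
      (simp_all only: g1 g2 h1 h2 verts G_interp H_interp)
  moreover have "roughness_sq cv T G =
      \<sigma> * (orient u1 u2 u4 * gradient_energy cv g1 + orient u2 u3 u4 * gradient_energy cv g2) / 2"
    using RG \<sigma> unfolding T_eq flip abs_minus_cancel by (simp add: insert_commute area algebra_simps add_divide_distrib)
  moreover have "roughness_sq cv Tstar H =
      \<sigma> * (orient u1 u2 u3 * gradient_energy cv h1 + orient u1 u3 u4 * gradient_energy cv h2) / 2"
    using RH \<sigma> unfolding Tstar_eq flip abs_minus_cancel by (simp add: area algebra_simps add_divide_distrib)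
  ultimately show ?thesis by simp
qed

end
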